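(* Let $\omega=\frac{-1+\sqrt{-3}}{2}$ and let $\frac{r}{s}>1$ be an irreducible fraction. If $r$ is not a multiple of $3$, then $J_{\frac rs}(\omega)\in\{\pm1,\pm\omega,\pm\omega^2\}$; if $r$ is a multiple of $3$, then $J_{\frac rs}(\omega)\in\{\pm(1-\omega),\pm\omega(1-\omega),\pm\omega^2(1-\omega)\}$. In particular, $|V_{\frac rs}(-\omega)|=|J_{\frac rs}(\omega)|$ equals $\sqrt3$ if $3\mid r$ and $1$ otherwise.
   Context: For a rational $\alpha>0$, $L(\alpha)$ denotes the rational (two-bridge) link associated with $\alpha$ via its continued fraction expansion, and $V_\alpha(t)\in\mathbb Z[t^{\pm1/2}]$ its Jones polynomial. The normalized Jones polynomial is $J_\alpha(q)=\pm t^{-h}V_\alpha(t)|_{t=-q^{-1}}$, where $\pm t^h$ is the leading term of $V_\alpha(t)$. It is known that for $\alpha>1$, $J_\alpha(q)=q\mathcal{R}_\alpha(q)+(1-q)\mathcal{S}_\alpha(q)$, where: $[c]_q=\frac{1-q^c}{1-q}$; writing $\alpha=c_1-\cfrac{1}{c_2-\cfrac{1}{\ddots-\cfrac{1}{c_l}}}$ with integers $c_j\ge2$ (unique) and $M^-_q(c)=\begin{pmatrix}[c]_q & -q^{c-1}\\ 1 & 0\end{pmatrix}$, one has $\begin{pmatrix}\mathcal{R}_\alpha(q)\\ \mathcal{S}_\alpha(q)\end{pmatrix}=M^-_q(c_1)\cdots M^-_q(c_l)\begin{pmatrix}1\\0\end{pmatrix}$. An irreducible fraction $\frac rs$ means $\gcd(r,s)=1$,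 $s>0$. *)

theory Defs
  imports Complex_Main "HOL-Library.Poly_Mapping"
begin

section \<open>Link diagrams\<close>

text \<open>
  Link diagrams are given by planar diagram codes.  The arcs of the diagram carry labels, and
  every label occurs exactly twice.  \<open>Cross a b c d\<close> is a crossing whose four incident arcs are,
  in counterclockwise order, \<open>a, b, c, d\<close>, where \<open>a, c\<close> belong to the lower strand and \<open>b, d\<close> to
  the upper one.  \<open>Join a b\<close> is a bivalent vertex: the arcs \<open>a\<close> and \<open>b\<close> are glued end to end.
\<close>

datatype vertex = Cross nat nat nat nat | Join nat nat

type_synonym diagram = "vertex list"

subsection \<open>Orientations and writhe\<close>

text \<open>
  An orientation chooses a direction for each strand of each vertex (the second flag is
  irrelevant at a \<open>Join\<close>).  It is consistent if no arc leaves two vertices and no arc enters two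
  vertices; since every arc has two ends, it then leaves one vertex and enters one.
\<close>

fun directed_strands :: "vertex \<Rightarrow> bool \<times> bool \<Rightarrow> (nat \<times> nat) list" where
  "directed_strands (Cross a b c d) (u, v) =
     [if u then (a, c) else (c, a), if v then (b, d) else (d, b)]"
| "directed_strands (Join a b) (u, v) = [if u then (a, b) else (b, a)]"

definition diagram_strands :: "diagram \<Rightarrow> (bool \<times> bool) list \<Rightarrow> (nat \<times> nat) list" where
  "diagram_strands D os = concat (map2 directed_strands D os)"

definition is_orientation :: "diagram \<Rightarrow> (bool \<times> bool) list \<Rightarrow> bool" where
  "is_orientation D os \<longleftrightarrow> length os = length D \<and>
     distinct (map fst (diagram_strands D os)) \<and> distinct (map snd (diagram_strands D os))"

text \<open>
  With \<open>a\<close> at the south and the lower strand running north, the upper strand from \<open>b\<close> to \<open>d\<close> runs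
  from east to west, which is a negative crossing.
\<close>

fun crossing_sign :: "vertex \<Rightarrow> bool \<times> bool \<Rightarrow> int" where
  "crossing_sign (Cross a b c d) (u, v) = (if u = v then -1 else 1)"
| "crossing_sign (Join a b) (u, v) = 0"

definition writhe :: "diagram \<Rightarrow> (bool \<times> bool) list \<Rightarrow> int" where
  "writhe D os = sum_list (map2 crossing_sign D os)"

subsection \<open>The Kauffman bracket\<close>

text \<open>Laurent polynomials in one variable over the integers: the group ring of \<open>(int, +)\<close>.\<close>

type_synonym laurent = "int \<Rightarrow>\<^sub>0 int"

definition laurent_eval :: "laurent \<Rightarrow> complex \<Rightarrow> complex" where
  "laurent_eval p z = (\<Sum>k\<in>Poly_Mapping.keys p. of_int (Poly_Mapping.lookup p k) * z powi k)"

text \<open>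
  All states of a diagram, each given by the number of A-smoothings minus the number of
  B-smoothings together with the resulting list of connections between arcs.  The A-smoothing opens
  the two regions swept out when the upper strand is rotated counterclockwise, so it connects
  \<open>a\<close> with \<open>b\<close> and \<open>c\<close> with \<open>d\<close>.
\<close>

fun states :: "diagram \<Rightarrow> (int \<times> (nat \<times> nat) list) list" where
  "states [] = [(0, [])]"
| "states (Cross a b c d # D) =
     map (\<lambda>(e, E). (e + 1, (a, b) # (c, d) # E)) (states D) @
     map (\<lambda>(e, E). (e - 1, (a, d) # (b, c) # E)) (states D)"
| "states (Join a b # D) = map (\<lambda>(e, E). (e, (a, b) # E)) (states D)"

text \<open>The number of closed curves of a state: the connected components of the graph on the arcs.\<close>

definition loops :: "(nat \<times> nat) list \<Rightarrow> nat" where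
  "loops E = card (Field (set E) // (set E \<union> (set E)\<inverse>)\<^sup>*)"

text \<open>The variable is \<open>A\<close>; the bracket of the unknot without crossings is \<open>1\<close>.\<close>

definition kauffman_bracket :: "diagram \<Rightarrow> laurent" where
  "kauffman_bracket D =
     (\<Sum>(e, E)\<leftarrow>states D. Poly_Mapping.single e 1 *
        (- Poly_Mapping.single 2 1 - Poly_Mapping.single (-2) 1) ^ (loops E - 1))"

subsection \<open>The Jones polynomial\<close>

text \<open>\<open>(- A\<^sup>3)\<close> to the power of minus the writhe, times the bracket.\<close>

definition writhe_normalized_bracket :: "diagram \<Rightarrow> (bool \<times> bool) list \<Rightarrow> laurent" where
  "writhe_normalized_bracket D os =
     Poly_Mapping.single (- 3 * writhe D os) (if even (writhe D os) then 1 else -1) *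
     kauffman_bracket D"

text \<open>
  The Jones polynomial as a Laurent polynomial in \<open>t\<^bsup>1/2\<^esup>\<close>, obtained by substituting
  \<open>A = t\<^bsup>-1/4\<^esup>\<close>.  Only even powers of \<open>A\<close> occur (lemma \<open>even_exponents\<close> below), so the division
  is exact.
\<close>

definition jones_polynomial :: "diagram \<Rightarrow> (bool \<times> bool) list \<Rightarrow> laurent" where
  "jones_polynomial D os =
     (\<Sum>k\<in>Poly_Mapping.keys (writhe_normalized_bracket D os).
        Poly_Mapping.single (- (k div 2)) (Poly_Mapping.lookup (writhe_normalized_bracket D os) k))"

text \<open>
  For \<open>V\<close> in the variable \<open>t\<^bsup>1/2\<^esup>\<close> with leading term \<open>\<plusminus>t\<^bsup>h\<^esup>\<close>, where \<open>h = m / 2\<close>, the value of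
  \<open>\<plusminus>t\<^bsup>-h\<^esup> V(t)\<close> at \<open>t = -q\<^bsup>-1\<^esup>\<close>.  The exponents of \<open>t\<close> in the Jones polynomial of a link differ by
  integers, so the choice of the square root is immaterial.
\<close>

definition normalize_jones :: "laurent \<Rightarrow> complex \<Rightarrow> complex" where
  "normalize_jones V q =
     (let m = Max (Poly_Mapping.keys V); t_half = csqrt (- inverse q)
      in of_int (sgn (Poly_Mapping.lookup V m)) * t_half powi (- m) * laurent_eval V t_half)"

section \<open>Rational links\<close>

text \<open>Tangle diagrams with the labels of their four ends NW, NE, SW, SE.\<close>

datatype tangle = Tangle diagram nat nat nat nat

text \<open>\<open>zero_tangle\<close> consists of two horizontal arcs, \<open>infinity_tangle\<close> of two vertical ones.\<close>

definition zero_tangle :: tangle where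
  "zero_tangle = Tangle [Join 0 1, Join 2 3] 0 1 2 3"

definition infinity_tangle :: tangle where
  "infinity_tangle = Tangle [Join 0 2, Join 1 3] 0 1 2 3"

text \<open>
  Adding one crossing on the right (replacing the fraction \<open>x\<close> of the tangle by \<open>x + 1\<close>), or at the
  bottom (replacing \<open>1/x\<close> by \<open>1/x + 1\<close>).  In both cases the upper strand runs from SW to NE, so that
  the arcs at the corners NW, SW, SE, NE of the new crossing are listed in this order.  The labels
  in use are always those below twice the number of vertices.
\<close>

fun twist_right :: "tangle \<Rightarrow> tangle" where
  "twist_right (Tangle D nw ne sw se) =
     (let n = 2 * length D in Tangle (Cross ne se (n + 1) n # D) nw n sw (n + 1))"

fun twist_bottom :: "tangle \<Rightarrow> tangle" where
  "twist_bottom (Tangle D nw ne sw se) =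
     (let n = 2 * length D in Tangle (Cross sw n (n + 1) se # D) nw ne n (n + 1))"

text \<open>
  The rational tangles with fraction \<open>x = a\<^sub>1 + 1/(a\<^sub>2 + 1/(\<dots> + 1/a\<^sub>n))\<close>, and with
  fraction \<open>1/x\<close>, respectively.
\<close>

fun cf_tangle :: "nat list \<Rightarrow> tangle" and cf_tangle_inverse :: "nat list \<Rightarrow> tangle" where
  "cf_tangle [] = infinity_tangle"
| "cf_tangle (a # as) = (twist_right ^^ a) (cf_tangle_inverse as)"
| "cf_tangle_inverse [] = zero_tangle"
| "cf_tangle_inverse (a # as) = (twist_bottom ^^ a) (cf_tangle as)"

fun numerator_closure :: "tangle \<Rightarrow> diagram" where
  "numerator_closure (Tangle D nw ne sw se) = Join nw ne # Join sw se # D"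

text \<open>The regular continued fraction expansion of \<open>r / s\<close>.\<close>

fun cfrac :: "nat \<Rightarrow> nat \<Rightarrow> nat list" where
  "cfrac r s = (if s = 0 then [] else (r div s) # cfrac s (r mod s))"

declare cfrac.simps [simp del]

definition rational_link :: "rat \<Rightarrow> diagram" where
  "rational_link \<alpha> =
     (case quotient_of \<alpha> of (r, s) \<Rightarrow> numerator_closure (cf_tangle (cfrac (nat r) (nat s))))"

text \<open>
  For a link with two components the Jones polynomial depends on the orientation, by a power of
  \<open>t\<close>, hence the additional argument.
\<close>

definition jones_V :: "rat \<Rightarrow> (bool \<times> bool) list \<Rightarrow> laurent" where
  "jones_V \<alpha> os = jones_polynomial (rational_link \<alpha>) os"

definition jones_J :: "rat \<Rightarrow> (bool \<times> bool) list \<Rightarrow> complex \<Rightarrow> complex" where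
  "jones_J \<alpha> os q = normalize_jones (jones_V \<alpha> os) q"

definition omega :: complex where
  "omega = (-1 + csqrt (-3)) / 2"

section \<open>Sanity checks\<close>

subsection \<open>Only even powers of \<open>A\<close> occur\<close>

definition parity_keys :: "int \<Rightarrow> laurent \<Rightarrow> bool" where
  "parity_keys n p \<longleftrightarrow> (\<forall>k\<in>Poly_Mapping.keys p. even (k - n))"

lemma parity_keys_mult:
  assumes "parity_keys m p" "parity_keys n q"
  shows "parity_keys (m + n) (p * q)"
  unfolding parity_keys_def
proof
  fix k assume "k \<in> Poly_Mapping.keys (p * q)"
  then obtain a b where "a \<in> Poly_Mapping.keys p" "b \<in> Poly_Mapping.keys q" "k = a + b"
    using keys_mult by blast
  then have "even (a - m)" "even (b - n)" "k - (m + n) = (a - m) + (b - n)"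
    using assms by (auto simp: parity_keys_def)
  then show "even (k - (m + n))"
    by presburger
qed

lemma parity_keys_add:
  assumes "parity_keys n p" "parity_keys n q"
  shows "parity_keys n (p + q)"
  using assms Poly_Mapping.keys_add[of p q] unfolding parity_keys_def by blast

lemma parity_keys_single: "even (k - n) \<Longrightarrow> parity_keys n (Poly_Mapping.single k c)"
  by (auto simp: parity_keys_def)

lemma parity_keys_power: "parity_keys 0 p \<Longrightarrow> parity_keys 0 (p ^ j)"
proof (induction j)
  case 0
  then show ?case by (simp add: parity_keys_def)
next
  case (Suc j)
  then show ?case using parity_keys_mult[of 0 p 0 "p ^ j"] by simp
qed

lemma parity_keys_sum_list:
  "(\<And>x. x \<in> set xs \<Longrightarrow> parity_keys n (f x)) \<Longrightarrow> parity_keys n (\<Sum>x\<leftarrow>xs. f x)"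
proof (induction xs)
  case Nil
  then show ?case by (simp add: parity_keys_def)
next
  case (Cons x xs)
  then show ?case by (simp add: parity_keys_add)
qed

fun is_cross :: "vertex \<Rightarrow> bool" where
  "is_cross (Cross a b c d) = True"
| "is_cross (Join a b) = False"

lemma states_parity: "(e, E) \<in> set (states D) \<Longrightarrow> even (e - int (length (filter is_cross D)))"
  by (induction D arbitrary: e E rule: states.induct) fastforce+

lemma writhe_parity:
  "length os = length D \<Longrightarrow> even (writhe D os - int (length (filter is_cross D)))"
proof (induction os D rule: list_induct2)
  case Nil
  then show ?case by (simp add: writhe_def)
next
  case (Cons x xs y ys)
  then show ?case
    by (cases y; cases x) (auto simp: writhe_def)
qed

lemma even_exponents:
  assumes "is_orientation D os" "k \<in> Poly_Mapping.keys (writhe_normalized_bracket D os)"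
  shows "even k"
proof -
  let ?n = "int (length (filter is_cross D))"
  let ?d = "- Poly_Mapping.single 2 1 - Poly_Mapping.single (-2) 1 :: laurent"
  have "?d = Poly_Mapping.single 2 (-1) + Poly_Mapping.single (-2) (-1)"
    by (simp flip: single_uminus)
  then have d: "parity_keys 0 ?d"
    by (simp add: parity_keys_add parity_keys_single)
  have "parity_keys ?n (Poly_Mapping.single e 1 * ?d ^ (loops E - 1))"
    if "(e, E) \<in> set (states D)" for e E
    using parity_keys_mult[OF parity_keys_single[OF states_parity[OF that]] parity_keys_power[OF d]]
    by simp
  then have b: "parity_keys ?n (kauffman_bracket D)"
    unfolding kauffman_bracket_def by (intro parity_keys_sum_list) auto
  have w: "even (writhe D os - ?n)"
    using assms(1) writhe_parity by (simp add: is_orientation_def)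
  have "even (- 3 * i - j)" if "even (i - j)" for i j :: int
    using that by presburger
  from this[OF w] have "parity_keys ?n
      (Poly_Mapping.single (- 3 * writhe D os) (if even (writhe D os) then 1 else -1))"
    by (rule parity_keys_single)
  from parity_keys_mult[OF this b] have "even (k - (?n + ?n))"
    using assms(2) unfolding parity_keys_def writhe_normalized_bracket_def by blast
  moreover have "even i" if "even (i - (j + j))" for i j :: int
    using that by presburger
  ultimately show ?thesis
    by blast
qed

subsection \<open>Rational links can be oriented\<close>

text \<open>
  A flag of an end tells whether the strand at this end is directed out of the tangle.
\<close>

fun tangle_orientable :: "tangle \<Rightarrow> bool \<Rightarrow> bool \<Rightarrow> bool \<Rightarrow> bool \<Rightarrow> bool" where
  "tangle_orientable (Tangle D nw ne sw se) x y z w \<longleftrightarrow>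
     (\<exists>os. is_orientation D os \<and>
       (\<forall>(a, b)\<in>set (diagram_strands D os). a < 2 * length D \<and> b < 2 * length D) \<and>
       (\<forall>(e, f)\<in>{(nw, x), (ne, y), (sw, z), (se, w)}. e < 2 * length D \<and>
          e \<notin> (if f then fst else snd) ` set (diagram_strands D os))) \<and>
     distinct [nw, ne, sw, se]"

lemma twist_right_orientable:
  assumes "tangle_orientable T x y z w"
  shows "tangle_orientable (twist_right T) x w z y"
proof (cases T)
  case (Tangle D nw ne sw se)
  with assms obtain os where os: "is_orientation D os"
    "\<forall>(a, b)\<in>set (diagram_strands D os). a < 2 * length D \<and> b < 2 * length D"
    "\<forall>(e, f)\<in>{(nw, x), (ne, y), (sw, z), (se, w)}. e < 2 * length D \<and>
       e \<notin> (if f then fst else snd) ` set (diagram_strands D os)"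
    and dist: "distinct [nw, ne, sw, se]"
    by auto
  define n where "n = 2 * length D"
  have fresh: "n \<notin> fst ` set (diagram_strands D os)" "n \<notin> snd ` set (diagram_strands D os)"
    "Suc n \<notin> fst ` set (diagram_strands D os)" "Suc n \<notin> snd ` set (diagram_strands D os)"
    using os(2) by (fastforce simp: n_def)+
  have strands: "diagram_strands (Cross ne se (n + 1) n # D) ((y, w) # os) =
      (if y then (ne, n + 1) else (n + 1, ne)) # (if w then (se, n) else (n, se)) #
      diagram_strands D os"
    by (simp add: diagram_strands_def)
  have 1: "is_orientation (Cross ne se (n + 1) n # D) ((y, w) # os)"
    using os(1,3) fresh dist unfolding is_orientation_def strands
    by (auto simp: n_def split: if_splits)
  have 2: "\<forall>(a, b)\<in>set (diagram_strands (Cross ne se (n + 1) n # D) ((y, w) # os)).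
      a < n + 2 \<and> b < n + 2"
    using os(2,3) unfolding strands by (fastforce simp: n_def split: if_splits)
  have 3: "\<forall>(e, f)\<in>{(nw, x), (n, w), (sw, z), (n + 1, y)}. e < n + 2 \<and>
      e \<notin> (if f then fst else snd) `
        set (diagram_strands (Cross ne se (n + 1) n # D) ((y, w) # os))"
    using os(3) fresh dist unfolding strands by (auto simp: n_def split: if_splits)
  have 4: "distinct [nw, n, sw, n + 1]"
    using os(3) dist by (auto simp: n_def)
  have len: "2 * length (Cross ne se (n + 1) n # D) = n + 2"
    by (simp add: n_def)
  have "tangle_orientable (Tangle (Cross ne se (n + 1) n # D) nw n sw (n + 1)) x w z y"
    unfolding tangle_orientable.simps len
    by (intro conjI exI[of _ "(y, w) # os"] 1 2 3 4)
  then show ?thesis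
    by (simp add: Tangle n_def Let_def)
qed

lemma twist_bottom_orientable:
  assumes "tangle_orientable T x y z w"
  shows "tangle_orientable (twist_bottom T) x y w z"
proof (cases T)
  case (Tangle D nw ne sw se)
  with assms obtain os where os: "is_orientation D os"
    "\<forall>(a, b)\<in>set (diagram_strands D os). a < 2 * length D \<and> b < 2 * length D"
    "\<forall>(e, f)\<in>{(nw, x), (ne, y), (sw, z), (se, w)}. e < 2 * length D \<and>
       e \<notin> (if f then fst else snd) ` set (diagram_strands D os)"
    and dist: "distinct [nw, ne, sw, se]"
    by auto
  define n where "n = 2 * length D"
  have fresh: "n \<notin> fst ` set (diagram_strands D os)" "n \<notin> snd ` set (diagram_strands D os)"
    "Suc n \<notin> fst ` set (diagram_strands D os)" "Suc n \<notin> snd ` set (diagram_strands D os)"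
    using os(2) by (fastforce simp: n_def)+
  have strands: "diagram_strands (Cross sw n (n + 1) se # D) ((z, \<not> w) # os) =
      (if z then (sw, n + 1) else (n + 1, sw)) # (if w then (se, n) else (n, se)) #
      diagram_strands D os"
    by (simp add: diagram_strands_def)
  have 1: "is_orientation (Cross sw n (n + 1) se # D) ((z, \<not> w) # os)"
    using os(1,3) fresh dist unfolding is_orientation_def strands
    by (auto simp: n_def split: if_splits)
  have 2: "\<forall>(a, b)\<in>set (diagram_strands (Cross sw n (n + 1) se # D) ((z, \<not> w) # os)).
      a < n + 2 \<and> b < n + 2"
    using os(2,3) unfolding strands by (fastforce simp: n_def split: if_splits)
  have 3: "\<forall>(e, f)\<in>{(nw, x), (ne, y), (n, w), (n + 1, z)}. e < n + 2 \<and>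
      e \<notin> (if f then fst else snd) `
        set (diagram_strands (Cross sw n (n + 1) se # D) ((z, \<not> w) # os))"
    using os(3) fresh dist unfolding strands by (auto simp: n_def split: if_splits)
  have 4: "distinct [nw, ne, n, n + 1]"
    using os(3) dist by (auto simp: n_def)
  have len: "2 * length (Cross sw n (n + 1) se # D) = n + 2"
    by (simp add: n_def)
  have "tangle_orientable (Tangle (Cross sw n (n + 1) se # D) nw ne n (n + 1)) x y w z"
    unfolding tangle_orientable.simps len
    by (intro conjI exI[of _ "(z, \<not> w) # os"] 1 2 3 4)
  then show ?thesis
    by (simp add: Tangle n_def Let_def)
qed

text \<open>The three ways in which the two arcs of a tangle can connect its ends.\<close>

definition tangle_arcs :: "tangle \<Rightarrow> bool" where
  "tangle_arcs T \<longleftrightarrow>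
     (\<forall>x y. tangle_orientable T x (\<not> x) y (\<not> y)) \<or>
     (\<forall>x y. tangle_orientable T x y (\<not> x) (\<not> y)) \<or>
     (\<forall>x y. tangle_orientable T x y (\<not> y) (\<not> x))"

lemma tangle_arcs_right: "tangle_arcs T \<Longrightarrow> tangle_arcs (twist_right T)"
  unfolding tangle_arcs_def by (auto simp: all_bool_eq intro: twist_right_orientable)

lemma tangle_arcs_bottom: "tangle_arcs T \<Longrightarrow> tangle_arcs (twist_bottom T)"
  unfolding tangle_arcs_def by (auto simp: all_bool_eq intro: twist_bottom_orientable)

lemma tangle_arcs_zero: "tangle_arcs zero_tangle"
proof -
  have "tangle_orientable zero_tangle x (\<not> x) y (\<not> y)" for x y
    unfolding zero_tangle_def tangle_orientable.simps
    by (intro conjI exI[of _ "[(\<not> x, True), (\<not> y, True)]"])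
      (auto simp: is_orientation_def diagram_strands_def)
  then show ?thesis by (simp add: tangle_arcs_def)
qed

lemma tangle_arcs_infinity: "tangle_arcs infinity_tangle"
proof -
  have "tangle_orientable infinity_tangle x y (\<not> x) (\<not> y)" for x y
    unfolding infinity_tangle_def tangle_orientable.simps
    by (intro conjI exI[of _ "[(\<not> x, True), (\<not> y, True)]"])
      (auto simp: is_orientation_def diagram_strands_def)
  then show ?thesis by (simp add: tangle_arcs_def)
qed

lemma tangle_arcs_cf: "tangle_arcs (cf_tangle as)" "tangle_arcs (cf_tangle_inverse bs)"
proof (induction as and bs rule: cf_tangle_cf_tangle_inverse.induct)
  case (2 a as)
  then show ?case by (induction a) (auto intro: tangle_arcs_right)
next
  case (4 a as)
  then show ?case by (induction a) (auto intro: tangle_arcs_bottom)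
qed (simp_all add: tangle_arcs_zero tangle_arcs_infinity)

lemma closure_orientable:
  assumes "tangle_orientable T x (\<not> x) y (\<not> y)"
  shows "\<exists>os. is_orientation (numerator_closure T) os"
proof (cases T)
  case (Tangle D nw ne sw se)
  with assms obtain os where os: "is_orientation D os"
    "\<forall>(e, f)\<in>{(nw, x), (ne, \<not> x), (sw, y), (se, \<not> y)}. e < 2 * length D \<and>
       e \<notin> (if f then fst else snd) ` set (diagram_strands D os)"
    and dist: "distinct [nw, ne, sw, se]"
    by auto
  have strands: "diagram_strands (Join nw ne # Join sw se # D) ((x, True) # (y, True) # os) =
      (if x then (nw, ne) else (ne, nw)) # (if y then (sw, se) else (se, sw)) #
      diagram_strands D os"
    by (simp add: diagram_strands_def)
  have "is_orientation (Join nw ne # Join sw se # D) ((x, True) # (y, True) # os)"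
    using os dist unfolding is_orientation_def strands by (auto split: if_splits)
  then show ?thesis
    by (auto simp: Tangle)
qed

lemma rational_link_orientable: "\<exists>os. is_orientation (rational_link \<alpha>) os"
proof -
  have "\<exists>os. is_orientation (numerator_closure T) os" if "tangle_arcs T" for T
    using that unfolding tangle_arcs_def
  proof (elim disjE)
    assume "\<forall>x y. tangle_orientable T x (\<not> x) y (\<not> y)"
    then show ?thesis using closure_orientable by blast
  next
    assume "\<forall>x y. tangle_orientable T x y (\<not> x) (\<not> y)"
    then have "tangle_orientable T True False (\<not> True) (\<not> False)" by blast
    then show ?thesis using closure_orientable[of T True False] by simp
  next
    assume "\<forall>x y. tangle_orientable T x y (\<not> y) (\<not> x)"
    then have "tangle_orientable T True False (\<not> False) (\<not> True)" by blast
    then show ?thesis using closure_orientable[of T True True] by simp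
  qed
  then show ?thesis
    using tangle_arcs_cf(1) by (simp add: rational_link_def split: prod.split)
qed

end

theory Submission
  imports Defs
begin

text \<open>
  The Kauffman bracket of a rational tangle is a combination \<open>p [0] + q [\<infinity>]\<close> of the brackets of
  the two trivial tangles, and adding a crossing acts linearly on \<open>(p, q)\<close>.  If \<open>t = A\<^bsup>-4\<^esup>\<close> is a
  primitive 6th root of unity, then, up to factors of modulus 1, this action permutes four vectors
  in the same way as the action on fractions permutes the projective line over the field with three
  elements.  Hence the bracket of the numerator closure has modulus \<open>\<surd>3\<close> or \<open>1\<close>, according to
  whether \<open>3\<close> divides \<open>r\<close>.  All exponents of the bracket agree modulo \<open>4\<close>, so \<open>J(\<omega>)\<close> is
  an Eisenstein integer, and those of norm \<open>1\<close> and \<open>3\<close> are the listed ones.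
\<close>

section \<open>Components of states\<close>

definition conn :: "(nat \<times> nat) list \<Rightarrow> (nat \<times> nat) set" where
  "conn E = (set E \<union> (set E)\<inverse>)\<^sup>*"

lemma conn_refl [simp]: "(x, x) \<in> conn E"
  by (simp add: conn_def)

lemma conn_trans: "(x, y) \<in> conn E \<Longrightarrow> (y, z) \<in> conn E \<Longrightarrow> (x, z) \<in> conn E"
  unfolding conn_def by (rule rtrancl_trans)

lemma conn_sym: "(x, y) \<in> conn E \<Longrightarrow> (y, x) \<in> conn E"
  unfolding conn_def by (metis Un_commute converse_Un converse_converse rtrancl_converseI)

lemma conn_commute: "(x, y) \<in> conn E \<longleftrightarrow> (y, x) \<in> conn E"
  using conn_sym by blast

lemma conn_cong: "(x, y) \<in> conn E \<Longrightarrow> (x, z) \<in> conn E \<longleftrightarrow> (y, z) \<in> conn E"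
  using conn_sym conn_trans by blast

lemma conn_Image_eq_iff: "conn E `` {x} = conn E `` {y} \<longleftrightarrow> (x, y) \<in> conn E"
  by (auto dest: conn_sym conn_trans)

text \<open>A path can be shortened to one that crosses the new edge at most once, in one direction
  or the other.\<close>

lemma conn_Cons:
  "(x, y) \<in> conn ((a, b) # E) \<longleftrightarrow> (x, y) \<in> conn E \<or>
     (x, a) \<in> conn E \<and> (b, y) \<in> conn E \<or> (x, b) \<in> conn E \<and> (a, y) \<in> conn E"
proof
  assume "(x, y) \<in> conn ((a, b) # E)"
  then have "(x, y) \<in> (set ((a, b) # E) \<union> (set ((a, b) # E))\<inverse>)\<^sup>*"
    by (simp add: conn_def)
  then show "(x, y) \<in> conn E \<or>
     (x, a) \<in> conn E \<and> (b, y) \<in> conn E \<or> (x, b) \<in> conn E \<and> (a, y) \<in> conn E"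
  proof (induction rule: rtrancl_induct)
    case (step y z)
    from step.hyps(2) consider "(y, z) \<in> conn E" | "y = a" "z = b" | "y = b" "z = a"
      by (auto simp: conn_def)
    then show ?case
      using step.IH by cases (auto intro: conn_trans)
  qed simp
next
  have mono: "conn E \<subseteq> conn ((a, b) # E)"
    unfolding conn_def by (rule rtrancl_mono) auto
  have "(a, b) \<in> conn ((a, b) # E)"
    by (auto simp: conn_def)
  then show "(x, y) \<in> conn E \<or> (x, a) \<in> conn E \<and> (b, y) \<in> conn E \<or>
      (x, b) \<in> conn E \<and> (a, y) \<in> conn E \<Longrightarrow> (x, y) \<in> conn ((a, b) # E)"
    using mono by (meson conn_sym conn_trans subsetD)
qed

lemma conn_fresh:
  assumes "x \<notin> Field (set E)"
  shows "(x, y) \<in> conn E \<longleftrightarrow> x = y" "(y, x) \<in> conn E \<longleftrightarrow> x = y"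
proof -
  have "(x, y) \<in> conn E \<Longrightarrow> x = y" for y
    using assms unfolding conn_def by (auto elim: converse_rtranclE simp: Field_def)
  then show "(x, y) \<in> conn E \<longleftrightarrow> x = y" "(y, x) \<in> conn E \<longleftrightarrow> x = y"
    by (auto dest: conn_sym)
qed

lemma Field_Cons: "Field (set ((a, b) # E)) = insert a (insert b (Field (set E)))"
  by (auto simp: Field_def)

text \<open>The vertex set is a separate argument, so that a new label can first enter as an
  isolated point and be joined by an edge afterwards; \<open>conn E\<close> is reflexive on all
  natural numbers, so every \<open>V\<close> is allowed.\<close>

definition comps :: "nat set \<Rightarrow> (nat \<times> nat) list \<Rightarrow> nat" where
  "comps V E = card (V // conn E)"

lemma loops_eq_comps: "loops E = comps (Field (set E)) E"
  by (simp add: loops_def comps_def conn_def)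

lemma comps_insert_fresh:
  assumes "finite V" "x \<notin> V" "x \<notin> Field (set E)"
  shows "comps (insert x V) E = Suc (comps V E)"
proof -
  have "insert x V // conn E = insert (conn E `` {x}) (V // conn E)"
    by (auto simp: quotient_def)
  moreover have "conn E `` {x} \<notin> V // conn E"
    using assms by (auto simp: quotient_def conn_Image_eq_iff conn_fresh)
  ultimately show ?thesis
    using assms(1) by (simp add: comps_def quotient_def)
qed

lemma comps_Cons_connected:
  assumes "(a, b) \<in> conn E"
  shows "comps V ((a, b) # E) = comps V E"
proof -
  have "conn ((a, b) # E) = conn E"
    using assms by (auto simp: conn_Cons) (meson conn_sym conn_trans)+
  then show ?thesis
    by (simp add: comps_def)
qed

text \<open>The new edge merges the classes of \<open>a\<close> and \<open>b\<close> into their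
  union and leaves every other class alone.\<close>

lemma comps_Cons_disconnected:
  assumes "finite V" "a \<in> V" "b \<in> V" "(a, b) \<notin> conn E"
  shows "Suc (comps V ((a, b) # E)) = comps V E"
proof -
  let ?R = "conn E" and ?R' = "conn ((a, b) # E)"
  \<comment> \<open>The classes that the new edge leaves untouched.\<close>
  let ?Q = "V // ?R - {?R `` {a}, ?R `` {b}}"
  have R': "?R' `` {x} = (if (a, x) \<in> ?R \<or> (b, x) \<in> ?R then ?R `` {a} \<union> ?R `` {b} else ?R `` {x})"
    for x
  proof -
    have "(x, a) \<in> ?R \<longleftrightarrow> (a, x) \<in> ?R" "(x, b) \<in> ?R \<longleftrightarrow> (b, x) \<in> ?R"
      by (simp_all add: conn_commute)
    then show ?thesis
      using conn_cong[of a x E] conn_cong[of b x E] assms(4) by (auto simp: conn_Cons)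
  qed
  have Q: "?Q = (\<lambda>x. ?R `` {x}) ` {x \<in> V. (a, x) \<notin> ?R \<and> (b, x) \<notin> ?R}"
  proof -
    have "?R `` {x} \<noteq> ?R `` {a} \<and> ?R `` {x} \<noteq> ?R `` {b} \<longleftrightarrow> (a, x) \<notin> ?R \<and> (b, x) \<notin> ?R" for x
      unfolding conn_Image_eq_iff by (metis conn_sym)
    moreover have "V // ?R = (\<lambda>x. ?R `` {x}) ` V"
      by (auto simp: quotient_def)
    moreover have "f ` V - {p, q} = f ` {x \<in> V. P x}"
      if "\<And>x. f x \<noteq> p \<and> f x \<noteq> q \<longleftrightarrow> P x" for f :: "nat \<Rightarrow> nat set" and p q P
      using that by blast
    ultimately show ?thesis by simp
  qed
  let ?W = "{x \<in> V. (a, x) \<in> ?R \<or> (b, x) \<in> ?R}"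
  let ?U = "{x \<in> V. (a, x) \<notin> ?R \<and> (b, x) \<notin> ?R}"
  have "V // ?R' = (\<lambda>x. ?R' `` {x}) ` (?W \<union> ?U)"
    by (auto simp: quotient_def)
  also have "\<dots> = (\<lambda>x. ?R' `` {x}) ` ?W \<union> (\<lambda>x. ?R' `` {x}) ` ?U"
    by (rule image_Un)
  also have "(\<lambda>x. ?R' `` {x}) ` ?W = (\<lambda>x. ?R `` {a} \<union> ?R `` {b}) ` ?W"
    by (rule image_cong) (auto simp only: R' mem_Collect_eq if_True)
  also have "\<dots> = {?R `` {a} \<union> ?R `` {b}}"
    using assms(2) by (auto simp del: Un_iff)
  also have "(\<lambda>x. ?R' `` {x}) ` ?U = ?Q"
    unfolding Q by (rule image_cong) (simp_all only: R' mem_Collect_eq if_False simp_thms)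
  finally have 1: "V // ?R' = insert (?R `` {a} \<union> ?R `` {b}) ?Q"
    by simp
  have 2: "?R `` {a} \<union> ?R `` {b} \<notin> ?Q"
  proof
    assume "?R `` {a} \<union> ?R `` {b} \<in> ?Q"
    then obtain x where "(a, x) \<notin> ?R" "?R `` {a} \<union> ?R `` {b} = ?R `` {x}"
      unfolding Q by auto
    moreover have "a \<in> ?R `` {a} \<union> ?R `` {b}" by simp
    ultimately show False by (metis Image_singleton_iff conn_sym)
  qed
  have fin: "finite (V // ?R)"
    using assms(1) by (simp add: quotient_def)
  have "V // ?R = insert (?R `` {a}) (insert (?R `` {b}) ?Q)"
    using assms(2,3) by (auto simp: quotient_def)
  moreover have "?R `` {a} \<noteq> ?R `` {b}"
    using assms(4) by (simp add: conn_Image_eq_iff)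
  moreover have "?R `` {a} \<notin> ?Q" "?R `` {b} \<notin> ?Q" "finite ?Q"
    using fin by blast+
  ultimately have "card (V // ?R) = Suc (Suc (card ?Q))"
    by (metis card_insert_disjoint finite_insert insert_iff)
  then show ?thesis
    using 1 2 fin by (simp add: comps_def)
qed

section \<open>Change of the loop count under one new connection\<close>

lemma finite_Field_set: "finite (Field (set E))"
  by (simp add: finite_Field)

lemma loops_Cons_inner:
  assumes "a \<in> Field (set E)" "b \<in> Field (set E)"
  shows "loops ((a, b) # E) = (if (a, b) \<in> conn E then loops E else loops E - 1)"
  using assms comps_Cons_connected[of a b E "Field (set E)"]
    comps_Cons_disconnected[of "Field (set E)" a b E]
  by (auto simp: loops_eq_comps Field_Cons finite_Field_set insert_absorb simp del: list.set)

text \<open>The fresh label adds an isolated point, and the edge merges it into an old component;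
  the two changes cancel.\<close>

lemma loops_Cons_half_fresh:
  assumes "a \<in> Field (set E)" "b \<notin> Field (set E)"
  shows "loops ((a, b) # E) = loops E" "loops ((b, a) # E) = loops E"
proof -
  have ne: "a \<noteq> b" using assms by auto
  show "loops ((a, b) # E) = loops E" "loops ((b, a) # E) = loops E"
    using assms ne comps_insert_fresh[of "Field (set E)" b E]
      comps_Cons_disconnected[of "insert b (Field (set E))" a b E]
      comps_Cons_disconnected[of "insert b (Field (set E))" b a E]
    by (auto simp: loops_eq_comps Field_Cons finite_Field_set insert_absorb conn_fresh insert_commute
        simp del: list.set)
qed

text \<open>Two isolated points are added and one merging follows, a net gain of one.\<close>

lemma loops_Cons_fresh:
  assumes "a \<notin> Field (set E)" "b \<notin> Field (set E)" "a \<noteq> b"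
  shows "loops ((a, b) # E) = Suc (loops E)"
  using assms comps_insert_fresh[of "Field (set E)" b E]
    comps_insert_fresh[of "insert b (Field (set E))" a E]
    comps_Cons_disconnected[of "insert a (insert b (Field (set E)))" a b E]
  by (auto simp: loops_eq_comps Field_Cons finite_Field_set conn_fresh simp del: list.set)

section \<open>The bracket vector of a tangle\<close>

abbreviation monomial :: "int \<Rightarrow> laurent" where
  "monomial e \<equiv> Poly_Mapping.single e 1"

definition loop_value :: laurent where
  "loop_value = - monomial 2 - monomial (-2)"

text \<open>
  By planarity every state of a rational tangle joins its four ends like \<open>zero_tangle\<close>
  (\<open>flat\<close>) or like \<open>infinity_tangle\<close> (\<open>upright\<close>), never diagonally.
\<close>

definition flat :: "nat \<Rightarrow> nat \<Rightarrow> nat \<Rightarrow> nat \<Rightarrow> (nat \<times> nat) list \<Rightarrow> bool" where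
  "flat nw ne sw se E \<longleftrightarrow> (nw, ne) \<in> conn E \<and> (sw, se) \<in> conn E \<and> (nw, sw) \<notin> conn E"

definition upright :: "nat \<Rightarrow> nat \<Rightarrow> nat \<Rightarrow> nat \<Rightarrow> (nat \<times> nat) list \<Rightarrow> bool" where
  "upright nw ne sw se E \<longleftrightarrow> (nw, sw) \<in> conn E \<and> (ne, se) \<in> conn E \<and> (nw, ne) \<notin> conn E"

lemma not_flat_upright: "flat nw ne sw se E \<Longrightarrow> \<not> upright nw ne sw se E"
  by (simp add: flat_def upright_def)

text \<open>The labels in use form an initial segment, so \<open>n\<close> and \<open>Suc n\<close>
  are fresh and can name the two outer ends of the next crossing.\<close>

locale tangle_state =
  fixes n nw ne sw se :: nat and E :: "(nat \<times> nat) list"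
  assumes Field: "Field (set E) = {..<n}"
    and ends: "nw < n" "ne < n" "sw < n" "se < n"
begin

lemma fresh [simp]: "n \<notin> Field (set E)" "Suc n \<notin> Field (set E)"
  "n \<in> Field (set ((a, b) # E)) \<longleftrightarrow> n = a \<or> n = b"
  "Suc n \<in> Field (set ((a, b) # E)) \<longleftrightarrow> Suc n = a \<or> Suc n = b"
  unfolding Field_Cons by (auto simp: Field)

lemma conn_new [simp]:
  "(n, x) \<in> conn E \<longleftrightarrow> n = x" "(x, n) \<in> conn E \<longleftrightarrow> n = x"
  "(Suc n, x) \<in> conn E \<longleftrightarrow> Suc n = x" "(x, Suc n) \<in> conn E \<longleftrightarrow> Suc n = x"
  by (simp_all add: conn_fresh)

lemma ends_in_Field [simp]:
  "nw \<in> Field (set E)" "ne \<in> Field (set E)" "sw \<in> Field (set E)" "se \<in> Field (set E)"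
  "nw \<in> Field (set (x # E))" "ne \<in> Field (set (x # E))"
  "sw \<in> Field (set (x # E))" "se \<in> Field (set (x # E))"
  using ends by (cases x; auto simp: Field Field_Cons simp del: list.set)+

lemma ends_old [simp]:
  "nw \<noteq> n" "ne \<noteq> n" "sw \<noteq> n" "se \<noteq> n" "nw \<noteq> Suc n" "ne \<noteq> Suc n" "sw \<noteq> Suc n" "se \<noteq> Suc n"
  "n \<noteq> nw" "n \<noteq> ne" "n \<noteq> sw" "n \<noteq> se" "Suc n \<noteq> nw" "Suc n \<noteq> ne" "Suc n \<noteq> sw" "Suc n \<noteq> se"
  using ends by auto

section \<open>Smoothing a crossing added to a single state\<close>

lemma right_A:
  "flat nw ne sw se E \<Longrightarrow> upright nw n sw (Suc n) ((ne, se) # (Suc n, n) # E)"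
  "upright nw ne sw se E \<Longrightarrow> upright nw n sw (Suc n) ((ne, se) # (Suc n, n) # E)"
  by (auto simp: flat_def upright_def conn_Cons) (meson conn_sym conn_trans)+

lemma right_B:
  "flat nw ne sw se E \<Longrightarrow> flat nw n sw (Suc n) ((ne, n) # (se, Suc n) # E)"
  "upright nw ne sw se E \<Longrightarrow> upright nw n sw (Suc n) ((ne, n) # (se, Suc n) # E)"
  by (auto simp: flat_def upright_def conn_Cons)

lemma bottom_A:
  "flat nw ne sw se E \<Longrightarrow> flat nw ne n (Suc n) ((sw, n) # (Suc n, se) # E)"
  "upright nw ne sw se E \<Longrightarrow> upright nw ne n (Suc n) ((sw, n) # (Suc n, se) # E)"
  by (auto simp: flat_def upright_def conn_Cons)

lemma bottom_B:
  "flat nw ne sw se E \<Longrightarrow> flat nw ne n (Suc n) ((sw, se) # (n, Suc n) # E)"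
  "upright nw ne sw se E \<Longrightarrow> flat nw ne n (Suc n) ((sw, se) # (n, Suc n) # E)"
  by (auto simp: flat_def upright_def conn_Cons) (meson conn_sym conn_trans)+

text \<open>The arc between \<open>n\<close> and \<open>Suc n\<close> is a new component. The arc
  between \<open>ne\<close> and \<open>se\<close> merges two old ones if the state is flat, which
  offsets the gain, but closes an existing strand into a loop if it is upright.\<close>

lemma loops_right_A:
  "flat nw ne sw se E \<Longrightarrow> loops ((ne, se) # (Suc n, n) # E) = loops E"
  "upright nw ne sw se E \<Longrightarrow> loops ((ne, se) # (Suc n, n) # E) = Suc (loops E)"
  by (auto simp: flat_def upright_def conn_Cons loops_Cons_inner loops_Cons_fresh simp del: list.set)
    (meson conn_sym conn_trans)+

lemma loops_right_B: "loops ((ne, n) # (se, Suc n) # E) = loops E"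
  by (simp add: loops_Cons_half_fresh del: list.set)

lemma loops_bottom_A: "loops ((sw, n) # (Suc n, se) # E) = loops E"
  by (simp add: loops_Cons_half_fresh del: list.set)

text \<open>Flat and upright trade roles compared with \<open>loops_right_A\<close>: here
  \<open>sw\<close> and \<open>se\<close> are already connected in the flat state.\<close>

lemma loops_bottom_B:
  "flat nw ne sw se E \<Longrightarrow> loops ((sw, se) # (n, Suc n) # E) = Suc (loops E)"
  "upright nw ne sw se E \<Longrightarrow> loops ((sw, se) # (n, Suc n) # E) = loops E"
  by (auto simp: flat_def upright_def conn_Cons loops_Cons_inner loops_Cons_fresh simp del: list.set)
    (meson conn_sym conn_trans)+

text \<open>For a flat state both closing arcs join points that are already connected. For an
  upright state the first one merges the two strands, after which the second only closes up the
  result.\<close>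

lemma loops_closure:
  "flat nw ne sw se E \<Longrightarrow> loops ((nw, ne) # (sw, se) # E) = loops E"
  "upright nw ne sw se E \<Longrightarrow> loops ((nw, ne) # (sw, se) # E) = loops E - 1"
  by (auto simp: flat_def upright_def conn_Cons loops_Cons_inner simp del: list.set)
    (meson conn_sym conn_trans)+

lemma Field_twist:
  "Field (set ((ne, se) # (Suc n, n) # E)) = {..<Suc (Suc n)}"
  "Field (set ((ne, n) # (se, Suc n) # E)) = {..<Suc (Suc n)}"
  "Field (set ((sw, n) # (Suc n, se) # E)) = {..<Suc (Suc n)}"
  "Field (set ((sw, se) # (n, Suc n) # E)) = {..<Suc (Suc n)}"
  using ends unfolding Field_Cons Field by auto

end

text \<open>The bound \<open>2 \<le> loops E\<close> records the two components through the ends; it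
  keeps the truncated exponent \<open>loops E - 2\<close> of the state sums faithful.\<close>

fun planar_states :: "tangle \<Rightarrow> bool" where
  "planar_states (Tangle D nw ne sw se) \<longleftrightarrow>
     (\<forall>(e, E)\<in>set (states D). tangle_state (2 * length D) nw ne sw se E \<and> 2 \<le> loops E \<and>
        (flat nw ne sw se E \<or> upright nw ne sw se E))"

text \<open>Two of the components of a state contain the ends; only the others are closed loops.\<close>

definition state_term :: "((nat \<times> nat) list \<Rightarrow> bool) \<Rightarrow> int \<times> (nat \<times> nat) list \<Rightarrow> laurent" where
  "state_term \<phi> = (\<lambda>(e, E). if \<phi> E then monomial e * loop_value ^ (loops E - 2) else 0)"

text \<open>Together with \<open>infinity_part\<close> this gives the coordinates of the tangle in
  the Kauffman bracket skein module of the disc with four boundary points, in the basis [0],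
  [\<infinity>].\<close>

fun zero_part :: "tangle \<Rightarrow> laurent" where
  "zero_part (Tangle D nw ne sw se) = (\<Sum>x\<leftarrow>states D. state_term (flat nw ne sw se) x)"

fun infinity_part :: "tangle \<Rightarrow> laurent" where
  "infinity_part (Tangle D nw ne sw se) = (\<Sum>x\<leftarrow>states D. state_term (upright nw ne sw se) x)"

text \<open>The skein relation at the first crossing, with the two smoothings of each remaining
  state collected in one summand.\<close>

lemma sum_list_states_Cross:
  fixes f :: "int \<times> (nat \<times> nat) list \<Rightarrow> laurent"
  shows "(\<Sum>x\<leftarrow>states (Cross a b c d # D). f x) =
     (\<Sum>(e, E)\<leftarrow>states D. f (e + 1, (a, b) # (c, d) # E) + f (e - 1, (a, d) # (b, c) # E))"
  by (simp add: sum_list_addf case_prod_unfold comp_def)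

section \<open>The twists as linear maps on the bracket vector\<close>

lemma states_CrossE:
  assumes "(e', E') \<in> set (states (Cross a b c d # D))"
  obtains e E where "(e, E) \<in> set (states D)"
    "E' = (a, b) # (c, d) # E \<or> E' = (a, d) # (b, c) # E"
  using assms by auto

lemma twist_right_planar:
  assumes "planar_states T"
  shows "planar_states (twist_right T)"
proof (cases T)
  case (Tangle D nw ne sw se)
  define n where "n = 2 * length D"
  have "tangle_state (Suc (Suc n)) nw n sw (Suc n) E' \<and> 2 \<le> loops E' \<and>
      (flat nw n sw (Suc n) E' \<or> upright nw n sw (Suc n) E')"
    if E': "(e', E') \<in> set (states (Cross ne se (Suc n) n # D))" for e' E'
  proof -
    from E' obtain e E where E: "(e, E) \<in> set (states D)"
      and E': "E' = (ne, se) # (Suc n, n) # E \<or> E' = (ne, n) # (se, Suc n) # E"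
      by (rule states_CrossE)
    from E assms have st: "tangle_state n nw ne sw se E" and loops: "2 \<le> loops E"
      and ty: "flat nw ne sw se E \<or> upright nw ne sw se E"
      by (auto simp: Tangle n_def)
    interpret tangle_state n nw ne sw se E by (fact st)
    have "Field (set E') = {..<Suc (Suc n)}"
      using E' by (elim disjE) (simp_all only: Field_twist)
    then have "tangle_state (Suc (Suc n)) nw n sw (Suc n) E'"
      using ends by (simp add: tangle_state_def)
    then show ?thesis
      using E' loops ty right_A right_B loops_right_A loops_right_B by (elim disjE) simp_all
  qed
  then show ?thesis
    by (auto simp: Tangle n_def Let_def simp del: states.simps)
qed

lemma twist_bottom_planar:
  assumes "planar_states T"
  shows "planar_states (twist_bottom T)"
proof (cases T)
  case (Tangle D nw ne sw se)
  define n where "n = 2 * length D"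
  have "tangle_state (Suc (Suc n)) nw ne n (Suc n) E' \<and> 2 \<le> loops E' \<and>
      (flat nw ne n (Suc n) E' \<or> upright nw ne n (Suc n) E')"
    if E': "(e', E') \<in> set (states (Cross sw n (Suc n) se # D))" for e' E'
  proof -
    from E' obtain e E where E: "(e, E) \<in> set (states D)"
      and E': "E' = (sw, n) # (Suc n, se) # E \<or> E' = (sw, se) # (n, Suc n) # E"
      by (rule states_CrossE)
    from E assms have st: "tangle_state n nw ne sw se E" and loops: "2 \<le> loops E"
      and ty: "flat nw ne sw se E \<or> upright nw ne sw se E"
      by (auto simp: Tangle n_def)
    interpret tangle_state n nw ne sw se E by (fact st)
    have "Field (set E') = {..<Suc (Suc n)}"
      using E' by (elim disjE) (simp_all only: Field_twist)
    then have "tangle_state (Suc (Suc n)) nw ne n (Suc n) E'"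
      using ends by (simp add: tangle_state_def)
    then show ?thesis
      using E' loops ty bottom_A bottom_B loops_bottom_A loops_bottom_B by (elim disjE) simp_all
  qed
  then show ?thesis
    by (auto simp: Tangle n_def Let_def simp del: states.simps)
qed

text \<open>With A the variable and d the value of a loop, a right crossing replaces [0] by A^(-1)
  [0] + A [\<infinity>] and multiplies [\<infinity>] by A^(-1) + A d, since there the A-smoothing
  splits off a closed curve.\<close>

lemma twist_right_parts:
  assumes "planar_states T"
  shows "zero_part (twist_right T) = monomial (-1) * zero_part T"
    and "infinity_part (twist_right T) =
      monomial 1 * zero_part T + (monomial (-1) + monomial 1 * loop_value) * infinity_part T"
proof -
  obtain D nw ne sw se where T: "T = Tangle D nw ne sw se" by (cases T)
  define n where "n = 2 * length D"
  define P Q where "P = state_term (flat nw ne sw se)" and "Q = state_term (upright nw ne sw se)"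
  define P' Q' where "P' = state_term (flat nw n sw (Suc n))"
    and "Q' = state_term (upright nw n sw (Suc n))"
  \<comment> \<open>The A- and the B-smoothing of the new crossing; both identities are checked
    state by state.\<close>
  let ?A = "\<lambda>(e, E). (e + 1, (ne, se) # (Suc n, n) # E)"
  let ?B = "\<lambda>(e :: int, E). (e - 1, (ne, n) # (se, Suc n) # E)"
  have twist: "twist_right T = Tangle (Cross ne se (Suc n) n # D) nw n sw (Suc n)"
    by (simp add: T n_def Let_def)
  have terms: "P' (?A x) + P' (?B x) = monomial (-1) * P x \<and>
      Q' (?A x) + Q' (?B x) = monomial 1 * P x + (monomial (-1) + monomial 1 * loop_value) * Q x"
    if x: "x \<in> set (states D)" for x
  proof -
    obtain e E where [simp]: "x = (e, E)" by fastforce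
    from x assms have st: "tangle_state n nw ne sw se E" and loops: "2 \<le> loops E"
      and ty: "flat nw ne sw se E \<or> upright nw ne sw se E"
      by (auto simp: T n_def)
    have shift: "monomial (e + 1) = monomial 1 * monomial e"
      "monomial (e - 1) = monomial (-1) * monomial e"
      by (simp_all add: mult_single add.commute)
    interpret tangle_state n nw ne sw se E by (fact st)
    from ty show "P' (?A x) + P' (?B x) = monomial (-1) * P x \<and>
        Q' (?A x) + Q' (?B x) = monomial 1 * P x + (monomial (-1) + monomial 1 * loop_value) * Q x"
    proof (elim disjE)
      assume fl: "flat nw ne sw se E"
      note s = fl not_flat_upright[OF fl] right_A(1)[OF fl] right_B(1)[OF fl] loops_right_A(1)[OF fl]
        loops_right_B not_flat_upright[OF right_B(1)[OF fl]]
      have "\<not> flat nw n sw (Suc n) ((ne, se) # (Suc n, n) # E)"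
        using right_A(1)[OF fl] not_flat_upright by blast
      with s show "P' (?A x) + P' (?B x) = monomial (-1) * P x \<and>
          Q' (?A x) + Q' (?B x) = monomial 1 * P x + (monomial (-1) + monomial 1 * loop_value) * Q x"
        by (simp add: P_def Q_def P'_def Q'_def state_term_def shift ring_distribs mult_ac)
    next
      assume up: "upright nw ne sw se E"
      have "\<not> flat nw ne sw se E" "\<not> flat nw n sw (Suc n) ((ne, se) # (Suc n, n) # E)"
        "\<not> flat nw n sw (Suc n) ((ne, n) # (se, Suc n) # E)"
        using up right_A(2)[OF up] right_B(2)[OF up] not_flat_upright by blast+
      \<comment> \<open>The extra closed curve gives one more factor \<open>loop_value\<close>; with
        truncated subtraction this rests on \<open>2 \<le> loops E\<close>.\<close>
      moreover have "Suc (loops E) - 2 = Suc (loops E - 2)"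
        using loops by simp
      ultimately show "P' (?A x) + P' (?B x) = monomial (-1) * P x \<and>
          Q' (?A x) + Q' (?B x) = monomial 1 * P x + (monomial (-1) + monomial 1 * loop_value) * Q x"
        using up right_A(2)[OF up] right_B(2)[OF up] loops_right_A(2)[OF up] loops_right_B
        by (simp add: P_def Q_def P'_def Q'_def state_term_def shift ring_distribs mult_ac)
    qed
  qed
  have "zero_part (twist_right T) = (\<Sum>x\<leftarrow>states D. P' (?A x) + P' (?B x))"
    unfolding twist zero_part.simps P'_def sum_list_states_Cross by (simp add: case_prod_unfold)
  also have "\<dots> = (\<Sum>x\<leftarrow>states D. monomial (-1) * P x)"
    by (intro arg_cong[of _ _ sum_list] map_cong refl) (use terms in blast)
  finally show "zero_part (twist_right T) = monomial (-1) * zero_part T"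
    by (simp add: T P_def sum_list_const_mult)
  have "infinity_part (twist_right T) = (\<Sum>x\<leftarrow>states D. Q' (?A x) + Q' (?B x))"
    unfolding twist infinity_part.simps Q'_def sum_list_states_Cross by (simp add: case_prod_unfold)
  also have "\<dots> = (\<Sum>x\<leftarrow>states D.
      monomial 1 * P x + (monomial (-1) + monomial 1 * loop_value) * Q x)"
    by (intro arg_cong[of _ _ sum_list] map_cong refl) (use terms in blast)
  finally show "infinity_part (twist_right T) =
      monomial 1 * zero_part T + (monomial (-1) + monomial 1 * loop_value) * infinity_part T"
    by (simp add: T P_def Q_def sum_list_const_mult sum_list_addf)
qed

text \<open>Exchanging [0] with [\<infinity>] and A with its inverse turns this into the formulas
  for the right twist.\<close>

lemma twist_bottom_parts:
  assumes "planar_states T"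
  shows "infinity_part (twist_bottom T) = monomial 1 * infinity_part T"
    and "zero_part (twist_bottom T) =
      monomial (-1) * infinity_part T + (monomial 1 + monomial (-1) * loop_value) * zero_part T"
proof -
  obtain D nw ne sw se where T: "T = Tangle D nw ne sw se" by (cases T)
  define n where "n = 2 * length D"
  define P Q where "P = state_term (flat nw ne sw se)" and "Q = state_term (upright nw ne sw se)"
  define P' Q' where "P' = state_term (flat nw ne n (Suc n))"
    and "Q' = state_term (upright nw ne n (Suc n))"
  let ?A = "\<lambda>(e, E). (e + 1, (sw, n) # (Suc n, se) # E)"
  let ?B = "\<lambda>(e :: int, E). (e - 1, (sw, se) # (n, Suc n) # E)"
  have twist: "twist_bottom T = Tangle (Cross sw n (Suc n) se # D) nw ne n (Suc n)"
    by (simp add: T n_def Let_def)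
  have terms: "Q' (?A x) + Q' (?B x) = monomial 1 * Q x \<and>
      P' (?A x) + P' (?B x) = monomial (-1) * Q x + (monomial 1 + monomial (-1) * loop_value) * P x"
    if x: "x \<in> set (states D)" for x
  proof -
    obtain e E where [simp]: "x = (e, E)" by fastforce
    from x assms have st: "tangle_state n nw ne sw se E" and loops: "2 \<le> loops E"
      and ty: "flat nw ne sw se E \<or> upright nw ne sw se E"
      by (auto simp: T n_def)
    have shift: "monomial (e + 1) = monomial 1 * monomial e"
      "monomial (e - 1) = monomial (-1) * monomial e"
      by (simp_all add: mult_single add.commute)
    interpret tangle_state n nw ne sw se E by (fact st)
    from ty show "Q' (?A x) + Q' (?B x) = monomial 1 * Q x \<and>
        P' (?A x) + P' (?B x) = monomial (-1) * Q x + (monomial 1 + monomial (-1) * loop_value) * P x"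
    proof (elim disjE)
      assume up: "upright nw ne sw se E"
      have "\<not> flat nw ne sw se E" "\<not> upright nw ne n (Suc n) ((sw, se) # (n, Suc n) # E)"
        "\<not> flat nw ne n (Suc n) ((sw, n) # (Suc n, se) # E)"
        using up bottom_A(2)[OF up] bottom_B(2)[OF up] not_flat_upright by blast+
      then show "Q' (?A x) + Q' (?B x) = monomial 1 * Q x \<and>
          P' (?A x) + P' (?B x) = monomial (-1) * Q x + (monomial 1 + monomial (-1) * loop_value) * P x"
        using up bottom_A(2)[OF up] bottom_B(2)[OF up] loops_bottom_B(2)[OF up] loops_bottom_A
        by (simp add: P_def Q_def P'_def Q'_def state_term_def shift ring_distribs mult_ac)
    next
      assume fl: "flat nw ne sw se E"
      have "\<not> upright nw ne sw se E" "\<not> upright nw ne n (Suc n) ((sw, se) # (n, Suc n) # E)"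
        "\<not> upright nw ne n (Suc n) ((sw, n) # (Suc n, se) # E)"
        using fl bottom_A(1)[OF fl] bottom_B(1)[OF fl] not_flat_upright by blast+
      moreover have "Suc (loops E) - 2 = Suc (loops E - 2)"
        using loops by simp
      ultimately show "Q' (?A x) + Q' (?B x) = monomial 1 * Q x \<and>
          P' (?A x) + P' (?B x) = monomial (-1) * Q x + (monomial 1 + monomial (-1) * loop_value) * P x"
        using fl bottom_A(1)[OF fl] bottom_B(1)[OF fl] loops_bottom_B(1)[OF fl] loops_bottom_A
        by (simp add: P_def Q_def P'_def Q'_def state_term_def shift ring_distribs mult_ac)
    qed
  qed
  have "infinity_part (twist_bottom T) = (\<Sum>x\<leftarrow>states D. Q' (?A x) + Q' (?B x))"
    unfolding twist infinity_part.simps Q'_def sum_list_states_Cross by (simp add: case_prod_unfold)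
  also have "\<dots> = (\<Sum>x\<leftarrow>states D. monomial 1 * Q x)"
    by (intro arg_cong[of _ _ sum_list] map_cong refl) (use terms in blast)
  finally show "infinity_part (twist_bottom T) = monomial 1 * infinity_part T"
    by (simp add: T Q_def sum_list_const_mult)
  have "zero_part (twist_bottom T) = (\<Sum>x\<leftarrow>states D. P' (?A x) + P' (?B x))"
    unfolding twist zero_part.simps P'_def sum_list_states_Cross by (simp add: case_prod_unfold)
  also have "\<dots> = (\<Sum>x\<leftarrow>states D.
      monomial (-1) * Q x + (monomial 1 + monomial (-1) * loop_value) * P x)"
    by (intro arg_cong[of _ _ sum_list] map_cong refl) (use terms in blast)
  finally show "zero_part (twist_bottom T) =
      monomial (-1) * infinity_part T + (monomial 1 + monomial (-1) * loop_value) * zero_part T"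
    by (simp add: T P_def Q_def sum_list_const_mult sum_list_addf)
qed

text \<open>Closing [0] gives two circles and closing [\<infinity>] gives one, with brackets
  \<open>loop_value\<close> and \<open>1\<close>.\<close>

lemma bracket_numerator_closure:
  assumes "planar_states T"
  shows "kauffman_bracket (numerator_closure T) = loop_value * zero_part T + infinity_part T"
proof -
  obtain D nw ne sw se where T: "T = Tangle D nw ne sw se" by (cases T)
  have "kauffman_bracket (numerator_closure T) =
      (\<Sum>(e, E)\<leftarrow>states D. monomial e * loop_value ^ (loops ((nw, ne) # (sw, se) # E) - 1))"
    by (simp add: T kauffman_bracket_def loop_value_def case_prod_unfold comp_def)
  also have "\<dots> = (\<Sum>x\<leftarrow>states D. loop_value * state_term (flat nw ne sw se) x +
      state_term (upright nw ne sw se) x)"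
  proof (intro arg_cong[of _ _ sum_list] map_cong refl)
    fix x assume x: "x \<in> set (states D)"
    obtain e E where [simp]: "x = (e, E)" by fastforce
    from x assms have st: "tangle_state (2 * length D) nw ne sw se E" and loops: "2 \<le> loops E"
      and ty: "flat nw ne sw se E \<or> upright nw ne sw se E"
      by (auto simp: T)
    interpret tangle_state "2 * length D" nw ne sw se E by (fact st)
    \<comment> \<open>The closure of a flat state has exponent \<open>loops E - 1\<close>, one more
      than in \<open>state_term\<close>.\<close>
    have "loops E - Suc 0 = Suc (loops E - 2)"
      using loops by simp
    then show "(case x of (e, E) \<Rightarrow>
        monomial e * loop_value ^ (loops ((nw, ne) # (sw, se) # E) - 1)) =
      loop_value * state_term (flat nw ne sw se) x + state_term (upright nw ne sw se) x"
      using ty loops_closure not_flat_upright[of nw ne sw se E]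
      by (auto simp: state_term_def mult_ac numeral_2_eq_2)
  qed
  also have "\<dots> = loop_value * zero_part T + infinity_part T"
    by (simp add: T sum_list_const_mult sum_list_addf)
  finally show ?thesis .
qed

section \<open>The two trivial tangles\<close>

lemma conn_Nil: "conn [] = Id"
  by (simp add: conn_def)

lemma loops_Nil: "loops [] = 0"
  by (simp add: loops_def quotient_def)

lemma zero_tangle_parts:
  "planar_states zero_tangle" "zero_part zero_tangle = 1" "infinity_part zero_tangle = 0"
proof -
  have F: "Field (set [(0, 1), (2, 3 :: nat)]) = {..<4}"
    unfolding Field_Cons by auto
  have L: "loops [(0, 1), (2, 3)] = 2"
    by (simp add: loops_Cons_fresh loops_Nil Field_Cons del: list.set(2))
  have fl: "flat 0 1 2 3 [(0, 1), (2, 3)]" "\<not> upright 0 1 2 3 [(0, 1), (2, 3)]"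
    by (simp_all add: flat_def upright_def conn_Cons conn_Nil)
  show "planar_states zero_tangle"
    using F L fl by (simp add: zero_tangle_def tangle_state_def)
  show "zero_part zero_tangle = 1" "infinity_part zero_tangle = 0"
    using L fl by (simp_all add: zero_tangle_def state_term_def)
qed

lemma infinity_tangle_parts:
  "planar_states infinity_tangle" "zero_part infinity_tangle = 0" "infinity_part infinity_tangle = 1"
proof -
  have F: "Field (set [(0, 2), (1, 3 :: nat)]) = {..<4}"
    unfolding Field_Cons by auto
  have L: "loops [(0, 2), (1, 3)] = 2"
    by (simp add: loops_Cons_fresh loops_Nil Field_Cons del: list.set(2))
  have fl: "upright 0 1 2 3 [(0, 2), (1, 3)]" "\<not> flat 0 1 2 3 [(0, 2), (1, 3)]"
    by (simp_all add: flat_def upright_def conn_Cons conn_Nil)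
  show "planar_states infinity_tangle"
    using F L fl by (simp add: infinity_tangle_def tangle_state_def)
  show "zero_part infinity_tangle = 0" "infinity_part infinity_tangle = 1"
    using L fl by (simp_all add: infinity_tangle_def state_term_def)
qed

section \<open>Evaluation of Laurent polynomials\<close>

lemma laurent_induct [case_names zero add]:
  fixes p :: laurent
  assumes "P 0" "\<And>p k c. P p \<Longrightarrow> P (p + Poly_Mapping.single k c)"
  shows "P p"
proof (induction p rule: update_induct)
  case (update f k v)
  have "Poly_Mapping.update k v f = f + Poly_Mapping.single k v"
    using update.hyps
    by (intro poly_mapping_eqI) (auto simp: lookup_update lookup_add lookup_single when_def in_keys_iff)
  then show ?case
    using assms(2)[OF update.IH] by simp
qed (use assms(1) in simp)

lemma laurent_eval_superset:
  assumes "finite K" "Poly_Mapping.keys p \<subseteq> K"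
  shows "laurent_eval p z = (\<Sum>k\<in>K. of_int (Poly_Mapping.lookup p k) * z powi k)"
  unfolding laurent_eval_def using assms by (intro sum.mono_neutral_left) (auto simp: in_keys_iff)

lemma laurent_eval_0 [simp]: "laurent_eval 0 z = 0"
  by (simp add: laurent_eval_def)

lemma laurent_eval_single [simp]:
  "laurent_eval (Poly_Mapping.single k c) z = of_int c * z powi k"
  by (simp add: laurent_eval_def)

lemma laurent_eval_1 [simp]: "laurent_eval 1 z = 1"
  by (simp add: laurent_eval_def)

lemma laurent_eval_add [simp]: "laurent_eval (p + q) z = laurent_eval p z + laurent_eval q z"
proof -
  let ?K = "Poly_Mapping.keys p \<union> Poly_Mapping.keys q"
  have "laurent_eval (p + q) z = (\<Sum>k\<in>?K. of_int (Poly_Mapping.lookup (p + q) k) * z powi k)"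
    by (rule laurent_eval_superset) (simp_all add: Poly_Mapping.keys_add)
  also have "\<dots> = laurent_eval p z + laurent_eval q z"
    by (simp add: laurent_eval_superset[of ?K p] laurent_eval_superset[of ?K q] lookup_add
        ring_distribs sum.distrib)
  finally show ?thesis .
qed

lemma laurent_eval_minus [simp]: "laurent_eval (- p) z = - laurent_eval p z"
  by (metis add.right_inverse add_eq_0_iff laurent_eval_0 laurent_eval_add)

lemma laurent_eval_diff [simp]: "laurent_eval (p - q) z = laurent_eval p z - laurent_eval q z"
  using laurent_eval_add[of p "- q" z] by simp

lemma laurent_eval_sum: "laurent_eval (\<Sum>i\<in>I. f i) z = (\<Sum>i\<in>I. laurent_eval (f i) z)"
  by (induction I rule: infinite_finite_induct) simp_all

text \<open>Multiplicativity comes from \<open>z powi (j + k) = z powi j * z powi k\<close>, which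
  can fail at \<open>z = 0\<close> for exponents of opposite sign.\<close>

lemma laurent_eval_mult [simp]:
  assumes "z \<noteq> 0"
  shows "laurent_eval (p * q) z = laurent_eval p z * laurent_eval q z"
proof (induction p rule: laurent_induct)
  case (add p k c)
  have "laurent_eval (Poly_Mapping.single k c * q) z =
      laurent_eval (Poly_Mapping.single k c) z * laurent_eval q z"
    using assms by (induction q rule: laurent_induct)
      (simp_all add: distrib_left mult_single power_int_add mult_ac)
  with add.IH show ?case
    by (simp add: distrib_right)
qed simp

section \<open>Exponents modulo 4 and slopes modulo 3\<close>

text \<open>Since t is A^(-4), exponents of A that agree modulo 4 belong to powers of t differing by
  integers.\<close>

definition keys_mod_4 :: "int \<Rightarrow> laurent \<Rightarrow> bool" where
  "keys_mod_4 c p \<longleftrightarrow> (\<forall>k\<in>Poly_Mapping.keys p. 4 dvd k - c)"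

lemma keys_mod_4_0: "keys_mod_4 c 0"
  by (simp add: keys_mod_4_def)

lemma keys_mod_4_add: "keys_mod_4 c p \<Longrightarrow> keys_mod_4 c q \<Longrightarrow> keys_mod_4 c (p + q)"
  using Poly_Mapping.keys_add[of p q] unfolding keys_mod_4_def by blast

lemma keys_mod_4_single_mult:
  assumes "keys_mod_4 c p" "4 dvd k + c - c'"
  shows "keys_mod_4 c' (Poly_Mapping.single k x * p)"
  unfolding keys_mod_4_def
proof
  fix j assume "j \<in> Poly_Mapping.keys (Poly_Mapping.single k x * p)"
  then obtain b where "b \<in> Poly_Mapping.keys p" "j = k + b"
    using keys_mult[of "Poly_Mapping.single k x" p] by (auto split: if_splits)
  then have "4 dvd b - c" "j - c' = (b - c) + (k + c - c')"
    using assms by (auto simp: keys_mod_4_def)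
  then show "4 dvd j - c'"
    using assms(2) by (metis dvd_add)
qed

text \<open>
  At a primitive 24th root of unity \<open>z\<close> the vector of a rational tangle takes, up to a factor of
  modulus 1, only four values, one for each point \<open>r : s\<close> of the projective line over the field
  with three elements: \<open>(1, 0)\<close>, \<open>(0, 1)\<close>, \<open>(1, z\<^sup>2)\<close>, \<open>(1, z\<^bsup>-2\<^esup>)\<close>.
\<close>

definition slope_vector :: "complex \<Rightarrow> complex \<Rightarrow> complex \<Rightarrow> int \<Rightarrow> int \<Rightarrow> bool" where
  "slope_vector z p q r s \<longleftrightarrow> (\<exists>u. cmod u = 1 \<and>
     (3 dvd r \<and> \<not> 3 dvd s \<and> p = u \<and> q = 0 \<or>
      \<not> 3 dvd r \<and> 3 dvd s \<and> p = 0 \<and> q = u \<or>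
      \<not> 3 dvd r \<and> \<not> 3 dvd s \<and> 3 dvd r - s \<and> p = u \<and> q = u * z ^ 2 \<or>
      \<not> 3 dvd r \<and> \<not> 3 dvd s \<and> 3 dvd r + s \<and> p = u \<and> q = u / z ^ 2))"

section \<open>Twists and closure at primitive 24th roots of unity\<close>

lemma primitive_24th_root:
  fixes z :: complex
  assumes "z ^ 8 - z ^ 4 + 1 = 0"
  shows "cmod z = 1" "z \<noteq> 0"
proof -
  \<comment> \<open>The hypothesis says that the 24th cyclotomic polynomial vanishes at
    \<open>z\<close>, and this polynomial divides the one on the left.\<close>
  have "z ^ 12 + 1 = (z ^ 4 + 1) * (z ^ 8 - z ^ 4 + 1)"
    by (simp add: algebra_simps flip: power_add)
  then have "z ^ 12 = -1"
    using assms by (simp add: eq_neg_iff_add_eq_0)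
  then have "cmod z ^ 12 = 1 ^ 12"
    by (metis norm_minus_cancel norm_one norm_power power_one)
  then show "cmod z = 1"
    by (metis norm_ge_zero power_eq_imp_eq_base zero_le_one zero_less_numeral)
  then show "z \<noteq> 0"
    by auto
qed

text \<open>Up to a factor of modulus 1, the map fixes \<open>(0, 1)\<close> and sends
  \<open>(1, 0)\<close> to \<open>(1, z^2)\<close>, this to \<open>(1, 1/z^2)\<close>, and that back
  to \<open>(1, 0)\<close>, just as adding 1 fixes the slope \<infinity> and rotates 0, 1, -1 modulo
  3.\<close>

lemma slope_vector_right:
  assumes z: "z ^ 8 - z ^ 4 + 1 = 0" and v: "slope_vector z p q r s"
  shows "slope_vector z (p / z) (z * p - z ^ 3 * q) (r + s) s"
proof -
  note [simp] = primitive_24th_root[OF z]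
  from v obtain u where u: "cmod u = 1" and cases:
    "3 dvd r \<and> \<not> 3 dvd s \<and> p = u \<and> q = 0 \<or>
      \<not> 3 dvd r \<and> 3 dvd s \<and> p = 0 \<and> q = u \<or>
      \<not> 3 dvd r \<and> \<not> 3 dvd s \<and> 3 dvd r - s \<and> p = u \<and> q = u * z ^ 2 \<or>
      \<not> 3 dvd r \<and> \<not> 3 dvd s \<and> 3 dvd r + s \<and> p = u \<and> q = u / z ^ 2"
    unfolding slope_vector_def by blast
  from cases show ?thesis
  proof (elim disjE conjE)
    assume a: "3 dvd r" "\<not> 3 dvd s" "p = u" "q = 0"
    have "\<not> 3 dvd r + s" "3 dvd r + s - s"
      using a by presburger+
    moreover have "z * p - z ^ 3 * q = u / z * z ^ 2"
      using a by (simp add: field_simps power2_eq_square)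
    ultimately show ?thesis
      unfolding slope_vector_def using a u by (intro exI[of _ "u / z"]) (simp add: norm_divide)
  next
    assume a: "\<not> 3 dvd r" "3 dvd s" "p = 0" "q = u"
    have "\<not> 3 dvd r + s"
      using a by presburger
    then show ?thesis
      unfolding slope_vector_def using a u
      by (intro exI[of _ "- (z ^ 3 * u)"]) (simp add: norm_mult norm_power)
  next
    assume a: "\<not> 3 dvd r" "\<not> 3 dvd s" "3 dvd r - s" "p = u" "q = u * z ^ 2"
    have "\<not> 3 dvd r + s" "3 dvd r + s + s"
      using a by presburger+
    moreover have "z * p - z ^ 3 * q = u / z / z ^ 2"
    proof -
      \<comment> \<open>Multiplying by \<open>z ^ 3\<close> exposes \<open>z ^ 4 - z ^ 8\<close>,
        which the cyclotomic relation turns into 1.\<close>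
      have "(z * p - z ^ 3 * q) * z ^ 3 = u * (z ^ 4 - z ^ 8)"
        by (simp add: a algebra_simps eval_nat_numeral)
      also have "z ^ 4 - z ^ 8 = 1"
        using z by (simp add: algebra_simps)
      finally show ?thesis
        by (simp add: field_simps eval_nat_numeral)
    qed
    ultimately show ?thesis
      unfolding slope_vector_def using a u by (intro exI[of _ "u / z"]) (simp add: norm_divide)
  next
    assume a: "\<not> 3 dvd r" "\<not> 3 dvd s" "3 dvd r + s" "p = u" "q = u / z ^ 2"
    have "z * p - z ^ 3 * q = 0"
      by (simp add: a field_simps eval_nat_numeral)
    then show ?thesis
      unfolding slope_vector_def using a u by (intro exI[of _ "u / z"]) (simp add: norm_divide)
  qed
qed

text \<open>Now \<open>(1, 0)\<close> is fixed and the other three rotate, \<open>(0, 1)\<close> to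
  \<open>(1, z^2)\<close> to \<open>(1, 1/z^2)\<close> to \<open>(0, 1)\<close>, as the reciprocal
  slope s/r increases by 1.\<close>

lemma slope_vector_bottom:
  assumes z: "z ^ 8 - z ^ 4 + 1 = 0" and v: "slope_vector z p q r s"
  shows "slope_vector z (q / z - p / z ^ 3) (z * q) r (s + r)"
proof -
  note [simp] = primitive_24th_root[OF z]
  from v obtain u where u: "cmod u = 1" and cases:
    "3 dvd r \<and> \<not> 3 dvd s \<and> p = u \<and> q = 0 \<or>
      \<not> 3 dvd r \<and> 3 dvd s \<and> p = 0 \<and> q = u \<or>
      \<not> 3 dvd r \<and> \<not> 3 dvd s \<and> 3 dvd r - s \<and> p = u \<and> q = u * z ^ 2 \<or>
      \<not> 3 dvd r \<and> \<not> 3 dvd s \<and> 3 dvd r + s \<and> p = u \<and> q = u / z ^ 2"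
    unfolding slope_vector_def by blast
  from cases show ?thesis
  proof (elim disjE conjE)
    assume a: "3 dvd r" "\<not> 3 dvd s" "p = u" "q = 0"
    have "\<not> 3 dvd s + r"
      using a by presburger
    then show ?thesis
      unfolding slope_vector_def using a u
      by (intro exI[of _ "- (u / z ^ 3)"]) (simp add: norm_divide norm_power)
  next
    assume a: "\<not> 3 dvd r" "3 dvd s" "p = 0" "q = u"
    have "\<not> 3 dvd s + r" "3 dvd r - (s + r)"
      using a by presburger+
    moreover have "z * q = u / z * z ^ 2"
      by (simp add: a field_simps power2_eq_square)
    ultimately show ?thesis
      unfolding slope_vector_def using a u by (intro exI[of _ "u / z"]) (simp add: norm_divide)
  next
    assume a: "\<not> 3 dvd r" "\<not> 3 dvd s" "3 dvd r - s" "p = u" "q = u * z ^ 2"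
    have "\<not> 3 dvd s + r" "3 dvd r + (s + r)"
      using a by presburger+
    \<comment> \<open>This is the new common factor of the vector, found by clearing denominators
      and using \<open>z ^ 4 - 1 = z ^ 8\<close>.\<close>
    moreover have "q / z - p / z ^ 3 = u * z ^ 5"
    proof -
      have "(q / z - p / z ^ 3) * z ^ 3 = u * (z ^ 4 - 1)"
        by (simp add: a field_simps eval_nat_numeral)
      also have "z ^ 4 - 1 = z ^ 8"
        using z by (simp add: algebra_simps)
      also have "u * z ^ 8 = u * z ^ 5 * z ^ 3"
        by (simp flip: power_add)
      finally show ?thesis
        by (metis mult_right_cancel power_not_zero primitive_24th_root(2) z)
    qed
    moreover have "z * q = u * z ^ 5 / z ^ 2"
      by (simp add: a field_simps eval_nat_numeral)
    ultimately show ?thesis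
      unfolding slope_vector_def using a u
      by (intro exI[of _ "u * z ^ 5"]) (simp add: norm_mult norm_power)
  next
    assume a: "\<not> 3 dvd r" "\<not> 3 dvd s" "3 dvd r + s" "p = u" "q = u / z ^ 2"
    have "q / z - p / z ^ 3 = 0" "z * q = u / z" "3 dvd s + r"
      using a by (simp_all add: field_simps eval_nat_numeral)
    then show ?thesis
      unfolding slope_vector_def using a u by (intro exI[of _ "u / z"]) (simp add: norm_divide)
  qed
qed

text \<open>With d = - z^2 - 1/z^2, the four vectors give d, 1, - 1/z^2 and - z^2 up to a factor of
  modulus 1; only d, which belongs to slope 0, has modulus \<open>sqrt 3\<close>.\<close>

lemma slope_vector_closure:
  assumes z: "z ^ 8 - z ^ 4 + 1 = 0" and v: "slope_vector z p q r s"
  shows "cmod ((- (z ^ 2) - 1 / z ^ 2) * p + q) = (if 3 dvd r then sqrt 3 else 1)"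
proof -
  note nz [simp] = primitive_24th_root[OF z]
  have d: "cmod (- (z ^ 2) - 1 / z ^ 2) = sqrt 3"
  proof -
    \<comment> \<open>In other words d^2 = z^4 + 2 + z^(-4) = 3, because z^4 + z^(-4) = 1.\<close>
    have "(- (z ^ 2) - 1 / z ^ 2) ^ 2 * z ^ 4 = 3 * z ^ 4 + (z ^ 8 - z ^ 4 + 1)"
      by (simp add: field_simps eval_nat_numeral)
    then have "(- (z ^ 2) - 1 / z ^ 2) ^ 2 = 3"
      using z by simp
    then have "cmod (- (z ^ 2) - 1 / z ^ 2) ^ 2 = 3"
      by (metis norm_numeral norm_power)
    then show ?thesis
      by (metis norm_ge_zero real_sqrt_unique)
  qed
  from v obtain u where u: "cmod u = 1" and cases:
    "3 dvd r \<and> \<not> 3 dvd s \<and> p = u \<and> q = 0 \<or>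
      \<not> 3 dvd r \<and> 3 dvd s \<and> p = 0 \<and> q = u \<or>
      \<not> 3 dvd r \<and> \<not> 3 dvd s \<and> 3 dvd r - s \<and> p = u \<and> q = u * z ^ 2 \<or>
      \<not> 3 dvd r \<and> \<not> 3 dvd s \<and> 3 dvd r + s \<and> p = u \<and> q = u / z ^ 2"
    unfolding slope_vector_def by blast
  have e: "(- (z ^ 2) - 1 / z ^ 2) * u + u * z ^ 2 = - (u / z ^ 2)"
    "(- (z ^ 2) - 1 / z ^ 2) * u + u / z ^ 2 = - (u * z ^ 2)"
    by (simp_all add: field_simps)
  from cases show ?thesis
    using u d e by (elim disjE conjE) (simp_all add: norm_mult norm_divide norm_power)
qed

text \<open>The induction invariant for a tangle of fraction r/s. The exponents of the two parts
  differ by 2 modulo 4, so that multiplying the zero part by \<open>loop_value\<close>, with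
  exponents 2 and -2, brings them into one class.\<close>

definition rational_tangle :: "tangle \<Rightarrow> int \<Rightarrow> int \<Rightarrow> bool" where
  "rational_tangle T r s \<longleftrightarrow> planar_states T \<and>
     (\<exists>c. keys_mod_4 c (zero_part T) \<and> keys_mod_4 (c + 2) (infinity_part T)) \<and>
     (\<forall>z. z ^ 8 - z ^ 4 + 1 = 0 \<longrightarrow>
        slope_vector z (laurent_eval (zero_part T) z) (laurent_eval (infinity_part T) z) r s)"

text \<open>The factors - A^3 and - A^(-3) by which a kink changes the bracket: a right twist of
  [\<infinity>] and a bottom twist of [0] each produce a kink.\<close>

lemma twist_coefficients:
  "monomial (-1) + monomial 1 * loop_value = - monomial 3"
  "monomial 1 + monomial (-1) * loop_value = - monomial (-3)"
  by (simp_all add: loop_value_def right_diff_distrib mult_single)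

lemma rational_tangle_right:
  assumes "rational_tangle T r s"
  shows "rational_tangle (twist_right T) (r + s) s"
proof -
  from assms obtain c where pl: "planar_states T"
    and c: "keys_mod_4 c (zero_part T)" "keys_mod_4 (c + 2) (infinity_part T)"
    and v: "\<And>z. z ^ 8 - z ^ 4 + 1 = 0 \<Longrightarrow>
        slope_vector z (laurent_eval (zero_part T) z) (laurent_eval (infinity_part T) z) r s"
    unfolding rational_tangle_def by blast
  note parts = twist_right_parts[OF pl, unfolded twist_coefficients single_uminus[symmetric]]
  \<comment> \<open>The factor of exponent -1 dictates the class \<open>c - 1\<close> of the zero
    part; the terms of the infinity part then have exponents c + 1 and c + 5, equal modulo
    4.\<close>
  have "keys_mod_4 (c - 1) (zero_part (twist_right T))"
    "keys_mod_4 (c - 1 + 2) (infinity_part (twist_right T))"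
    unfolding parts
    by (intro keys_mod_4_add keys_mod_4_single_mult[OF c(1)] keys_mod_4_single_mult[OF c(2)]; simp)+
  moreover have "slope_vector z (laurent_eval (zero_part (twist_right T)) z)
      (laurent_eval (infinity_part (twist_right T)) z) (r + s) s" if z: "z ^ 8 - z ^ 4 + 1 = 0" for z
    using slope_vector_right[OF z v[OF z]] primitive_24th_root[OF z] unfolding parts
    by (simp add: power_int_minus divide_inverse mult.commute)
  ultimately show ?thesis
    using twist_right_planar[OF pl] unfolding rational_tangle_def by blast
qed

lemma rational_tangle_bottom:
  assumes "rational_tangle T r s"
  shows "rational_tangle (twist_bottom T) r (s + r)"
proof -
  from assms obtain c where pl: "planar_states T"
    and c: "keys_mod_4 c (zero_part T)" "keys_mod_4 (c + 2) (infinity_part T)"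
    and v: "\<And>z. z ^ 8 - z ^ 4 + 1 = 0 \<Longrightarrow>
        slope_vector z (laurent_eval (zero_part T) z) (laurent_eval (infinity_part T) z) r s"
    unfolding rational_tangle_def by blast
  note parts = twist_bottom_parts[OF pl, unfolded twist_coefficients single_uminus[symmetric]]
  have "keys_mod_4 (c + 1) (zero_part (twist_bottom T))"
    "keys_mod_4 (c + 1 + 2) (infinity_part (twist_bottom T))"
    unfolding parts
    by (intro keys_mod_4_add keys_mod_4_single_mult[OF c(1)] keys_mod_4_single_mult[OF c(2)]; simp)+
  moreover have "slope_vector z (laurent_eval (zero_part (twist_bottom T)) z)
      (laurent_eval (infinity_part (twist_bottom T)) z) r (s + r)" if z: "z ^ 8 - z ^ 4 + 1 = 0" for z
    using slope_vector_bottom[OF z v[OF z]] primitive_24th_root[OF z] unfolding parts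
    by (simp add: power_int_minus divide_inverse mult.commute)
  ultimately show ?thesis
    using twist_bottom_planar[OF pl] unfolding rational_tangle_def by blast
qed

section \<open>Induction along the continued fraction\<close>

lemma rational_tangle_zero: "rational_tangle zero_tangle 0 1"
proof -
  have "keys_mod_4 0 1"
    by (simp add: keys_mod_4_def)
  then show ?thesis
    unfolding rational_tangle_def zero_tangle_parts
    using keys_mod_4_0 by (auto simp: slope_vector_def zero_tangle_parts)
qed

lemma rational_tangle_infinity: "rational_tangle infinity_tangle 1 0"
proof -
  have "keys_mod_4 (-2 + 2) 1"
    by (simp add: keys_mod_4_def)
  then have "\<exists>c. keys_mod_4 c 0 \<and> keys_mod_4 (c + 2) 1"
    using keys_mod_4_0 by blast
  then show ?thesis
    unfolding rational_tangle_def infinity_tangle_parts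
    by (auto simp: slope_vector_def infinity_tangle_parts)
qed

lemma rational_tangle_right_funpow:
  "rational_tangle T r s \<Longrightarrow> rational_tangle ((twist_right ^^ a) T) (r + int a * s) s"
  by (induction a) (auto dest: rational_tangle_right simp: algebra_simps)

lemma rational_tangle_bottom_funpow:
  "rational_tangle T r s \<Longrightarrow> rational_tangle ((twist_bottom ^^ a) T) r (s + int a * r)"
  by (induction a) (auto dest: rational_tangle_bottom simp: algebra_simps)

text \<open>Induction along Euclid's algorithm: \<open>r div s\<close> right twists turn the
  fraction (r mod s)/s into r/s. Both tangles are treated together because their recursions call
  each other.\<close>

lemma rational_tangle_cfrac:
  assumes "coprime r s"
  shows "rational_tangle (cf_tangle (cfrac r s)) (int r) (int s) \<and>
    rational_tangle (cf_tangle_inverse (cfrac r s)) (int s) (int r)"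
  using assms
proof (induction r s rule: cfrac.induct)
  case (1 r s)
  show ?case
  proof (cases "s = 0")
    case True
    \<comment> \<open>Coprimality with 0 forces \<open>r = 1\<close>, so the fractions are 1/0 and
      0/1.\<close>
    then show ?thesis
      using 1(2) rational_tangle_zero rational_tangle_infinity by (simp add: cfrac.simps)
  next
    case False
    have "coprime s (r mod s)"
      using 1(2) False by (simp add: coprime_commute)
    note IH = 1(1)[OF False this]
    have *: "int (r mod s) + int (r div s) * int s = int r"
      by (metis mod_div_mult_eq of_nat_add of_nat_mult)
    have "cfrac r s = (r div s) # cfrac s (r mod s)"
      using False by (simp add: cfrac.simps)
    then show ?thesis
      using rational_tangle_right_funpow[OF conjunct2[OF IH], of "r div s"]
        rational_tangle_bottom_funpow[OF conjunct1[OF IH], of "r div s"]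
      by (simp add: *)
  qed
qed

section \<open>Eisenstein integers\<close>

lemma omega_Complex: "omega = Complex (- 1 / 2) (sqrt 3 / 2)"
proof -
  have "csqrt (-3) = \<i> * sqrt 3"
    using csqrt_of_real_nonpos[of "-3"] by simp
  then show ?thesis
    by (simp add: omega_def complex_eq_iff)
qed

lemma omega_square: "omega ^ 2 = - 1 - omega"
  by (simp add: omega_Complex complex_eq_iff power2_eq_square field_simps)

lemma omega_mult_omega: "omega * omega = - 1 - omega"
  using omega_square by (simp add: power2_eq_square)

lemma omega_nonzero: "omega \<noteq> 0"
  by (simp add: omega_Complex complex_eq_iff)

lemma inverse_omega: "inverse omega = - 1 - omega"
proof -
  have "omega * (- 1 - omega) = 1"
    by (simp add: right_diff_distrib omega_mult_omega)
  then show ?thesis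
    by (rule inverse_unique)
qed

definition eisenstein :: "complex set" where
  "eisenstein = {of_int a + of_int b * omega |a b. True}"

lemma eisensteinI: "of_int a + of_int b * omega \<in> eisenstein"
  by (auto simp: eisenstein_def)

lemma eisenstein_of_int: "of_int a \<in> eisenstein"
  using eisensteinI[of a 0] by simp

lemma eisenstein_add: "x \<in> eisenstein \<Longrightarrow> y \<in> eisenstein \<Longrightarrow> x + y \<in> eisenstein"
  unfolding eisenstein_def
proof clarify
  fix a b c d
  show "\<exists>a' b'. of_int a + of_int b * omega + (of_int c + of_int d * omega) =
      of_int a' + of_int b' * omega \<and> True"
    by (rule exI[of _ "a + c"], rule exI[of _ "b + d"]) (simp add: algebra_simps)
qed

lemma eisenstein_mult: "x \<in> eisenstein \<Longrightarrow> y \<in> eisenstein \<Longrightarrow> x * y \<in> eisenstein"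
  unfolding eisenstein_def
proof clarify
  fix a b c d
  have "(of_int a + of_int b * omega) * (of_int c + of_int d * omega) =
      of_int a * of_int c + (of_int a * of_int d + of_int b * of_int c) * omega +
      of_int b * of_int d * omega ^ 2"
    by (simp add: algebra_simps power2_eq_square)
  also have "\<dots> = of_int (a * c - b * d) + of_int (a * d + b * c - b * d) * omega"
    unfolding omega_square by (simp add: algebra_simps)
  finally show "\<exists>a' b'. (of_int a + of_int b * omega) * (of_int c + of_int d * omega) =
      of_int a' + of_int b' * omega \<and> True"
    by blast
qed

lemma eisenstein_power: "x \<in> eisenstein \<Longrightarrow> x ^ n \<in> eisenstein"
  using eisenstein_of_int[of 1] by (induction n) (simp_all add: eisenstein_mult)

lemma eisenstein_power_int:
  "x \<in> eisenstein \<Longrightarrow> inverse x \<in> eisenstein \<Longrightarrow> x powi n \<in> eisenstein"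
  by (simp add: power_int_def eisenstein_power)

lemma eisenstein_sum: "(\<And>i. i \<in> I \<Longrightarrow> f i \<in> eisenstein) \<Longrightarrow> sum f I \<in> eisenstein"
  using eisenstein_of_int[of 0]
  by (induction I rule: infinite_finite_induct) (simp_all add: eisenstein_add)

section \<open>Eisenstein integers of norm 1 and 3\<close>

lemma cmod_eisenstein: "cmod (of_int a + of_int b * omega) ^ 2 = of_int (a ^ 2 - a * b + b ^ 2)"
  unfolding cmod_power2 by (simp add: omega_Complex power2_eq_square field_simps)

lemma eisenstein_norm_bound:
  fixes a b :: int
  assumes "a ^ 2 - a * b + b ^ 2 \<le> 3"
  shows "a \<in> {-2, -1, 0, 1, 2}"
proof -
  \<comment> \<open>Completing the square bounds \<open>a\<close>; the norm form is symmetric, so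
    \<open>b\<close> can be bounded in the same way.\<close>
  have "3 * a ^ 2 + (2 * b - a) ^ 2 = 4 * (a ^ 2 - a * b + b ^ 2)"
    by (simp add: power2_eq_square algebra_simps)
  moreover have "3 * x \<le> 12" if "3 * x + y = 4 * N" "N \<le> 3" "0 \<le> y" for x y N :: int
    using that by linarith
  ultimately have "3 * a ^ 2 \<le> 12"
    using assms zero_le_power2 by blast
  then have "\<bar>a\<bar> \<le> 2"
    using abs_le_square_iff[of a 2] by simp
  then show ?thesis
    by auto
qed

lemma eisenstein_norm_1:
  assumes "x \<in> eisenstein" "cmod x = 1"
  shows "x \<in> {1, -1, omega, - omega, omega ^ 2, - (omega ^ 2)}"
proof -
  obtain a b where x: "x = of_int a + of_int b * omega"
    using assms(1) by (auto simp: eisenstein_def)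
  have "of_int (a ^ 2 - a * b + b ^ 2) = (1 :: real)"
    unfolding cmod_eisenstein[symmetric] x[symmetric] using assms(2) by simp
  then have n: "a ^ 2 - a * b + b ^ 2 = 1"
    by linarith
  have "a \<in> {-2, -1, 0, 1, 2}" "b \<in> {-2, -1, 0, 1, 2}"
    using eisenstein_norm_bound[of a b] eisenstein_norm_bound[of b a] n
    by (simp_all add: algebra_simps)
  then show ?thesis
    using n by (auto simp: x omega_square)
qed

lemma eisenstein_norm_3:
  assumes "x \<in> eisenstein" "cmod x = sqrt 3"
  shows "x \<in> {1 - omega, - (1 - omega), omega * (1 - omega), - (omega * (1 - omega)),
    omega ^ 2 * (1 - omega), - (omega ^ 2 * (1 - omega))}"
proof -
  obtain a b where x: "x = of_int a + of_int b * omega"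
    using assms(1) by (auto simp: eisenstein_def)
  have "of_int (a ^ 2 - a * b + b ^ 2) = (3 :: real)"
    unfolding cmod_eisenstein[symmetric] x[symmetric] using assms(2) by simp
  then have n: "a ^ 2 - a * b + b ^ 2 = 3"
    by linarith
  have "a \<in> {-2, -1, 0, 1, 2}" "b \<in> {-2, -1, 0, 1, 2}"
    using eisenstein_norm_bound[of a b] eisenstein_norm_bound[of b a] n
    by (simp_all add: algebra_simps)
  then have "x \<in> {1 - omega, - (1 - omega), 1 + 2 * omega, - (1 + 2 * omega),
      - 2 - omega, - (- 2 - omega)}"
    using n by (auto simp: x)
  moreover have "omega * (1 - omega) = 1 + 2 * omega" "omega ^ 2 * (1 - omega) = - 2 - omega"
    by (simp_all add: omega_square omega_mult_omega algebra_simps)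
  ultimately show ?thesis
    by metis
qed

text \<open>The number - 1/omega = 1 + omega is a unit of the Eisenstein integers, and after
  division by \<open>t powi m\<close> only even powers of \<open>t\<close>, hence powers of this
  unit, remain.\<close>

lemma laurent_eval_eisenstein:
  assumes t: "t ^ 2 = - inverse omega" and even: "\<And>k. k \<in> Poly_Mapping.keys p \<Longrightarrow> even (k - m)"
  shows "t powi (- m) * laurent_eval p t \<in> eisenstein"
proof -
  have t0: "t \<noteq> 0"
    using t omega_nonzero by auto
  \<comment> \<open>The inverse is \<open>- omega\<close>.\<close>
  have unit: "1 + omega \<in> eisenstein" "inverse (1 + omega) \<in> eisenstein"
    using eisensteinI[of 1 1] eisensteinI[of 0 "-1"] inverse_omega
    by simp_all (metis add_uminus_conv_diff inverse_inverse_eq inverse_minus_eq minus_add_distrib minus_minus)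
  have "t powi (- m) * laurent_eval p t =
      (\<Sum>k\<in>Poly_Mapping.keys p. of_int (Poly_Mapping.lookup p k) * t powi (k - m))"
    using t0 by (simp add: laurent_eval_def sum_distrib_left power_int_diff power_int_minus field_simps)
  also have "\<dots> \<in> eisenstein"
  proof (intro eisenstein_sum eisenstein_mult eisenstein_of_int)
    fix k assume "k \<in> Poly_Mapping.keys p"
    then obtain j where "k - m = 2 * j"
      using even by blast
    then have "t powi (k - m) = (t ^ 2) powi j"
      by (simp add: power_int_mult)
    also have "t ^ 2 = 1 + omega"
      by (simp add: t inverse_omega)
    finally show "t powi (k - m) \<in> eisenstein"
      using unit by (simp add: eisenstein_power_int)
  qed
  finally show ?thesis .
qed

section \<open>The Jones polynomial of a rational link\<close>

lemma keys_sum: "Poly_Mapping.keys (\<Sum>i\<in>I. f i) \<subseteq> (\<Union>i\<in>I. Poly_Mapping.keys (f i))"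
proof (induction I rule: infinite_finite_induct)
  case (insert i I)
  then show ?case
    using Poly_Mapping.keys_add[of "f i" "\<Sum>i\<in>I. f i"] by auto
qed simp_all

text \<open>Here \<open>z\<close> is the value of A and \<open>t\<close> that of t^(1/2) = A^(-2);
  halving the exponents is exact by \<open>even_exponents\<close>.\<close>

lemma laurent_eval_jones_polynomial:
  assumes "is_orientation D os" "z \<noteq> 0" "t = inverse (z ^ 2)"
  shows "laurent_eval (jones_polynomial D os) t = laurent_eval (writhe_normalized_bracket D os) z"
proof -
  let ?W = "writhe_normalized_bracket D os"
  have "t powi (- (k div 2)) = z powi k" if "k \<in> Poly_Mapping.keys ?W" for k
  proof -
    have "k = 2 * (k div 2)"
      using even_exponents[OF assms(1) that] by simp
    then have "z powi k = (z ^ 2) powi (k div 2)"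
      by (metis power_int_mult power_int_numeral)
    then show ?thesis
      by (simp add: assms(3) power_int_minus power_int_inverse)
  qed
  then show ?thesis
    unfolding jones_polynomial_def laurent_eval_sum by (simp add: laurent_eval_def[of ?W])
qed

text \<open>Exponents of A that agree modulo 4 have halves of equal parity, so the powers of t in
  the Jones polynomial differ by integers.\<close>

lemma jones_polynomial_keys:
  assumes "is_orientation D os" "keys_mod_4 c (kauffman_bracket D)"
  shows "\<exists>m. \<forall>k\<in>Poly_Mapping.keys (jones_polynomial D os). even (k - m)"
proof -
  let ?W = "writhe_normalized_bracket D os"
  define c' where "c' = - 3 * writhe D os + c"
  have W: "keys_mod_4 c' ?W"
    unfolding writhe_normalized_bracket_def
    by (rule keys_mod_4_single_mult[OF assms(2)]) (simp add: c'_def)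
  have "even (k - (- (c' div 2)))" if "k \<in> Poly_Mapping.keys (jones_polynomial D os)" for k
  proof -
    have "k \<in> (\<Union>j\<in>Poly_Mapping.keys ?W.
        Poly_Mapping.keys (Poly_Mapping.single (- (j div 2)) (Poly_Mapping.lookup ?W j)))"
      using subsetD[OF keys_sum that[unfolded jones_polynomial_def]] .
    then obtain j where "j \<in> Poly_Mapping.keys ?W" "k = - (j div 2)"
      by (auto split: if_splits)
    moreover from this have "4 dvd j - c'"
      using W by (simp add: keys_mod_4_def)
    ultimately show ?thesis
      by presburger
  qed
  then show ?thesis
    by blast
qed

lemma rational_tangle_bracket:
  assumes "rational_tangle T r s"
  shows "\<exists>c. keys_mod_4 c (kauffman_bracket (numerator_closure T))"
    and "z ^ 8 - z ^ 4 + 1 = 0 \<Longrightarrow>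
      cmod (laurent_eval (kauffman_bracket (numerator_closure T)) z) = (if 3 dvd r then sqrt 3 else 1)"
proof -
  from assms obtain c where pl: "planar_states T"
    and c: "keys_mod_4 c (zero_part T)" "keys_mod_4 (c + 2) (infinity_part T)"
    and v: "\<And>z. z ^ 8 - z ^ 4 + 1 = 0 \<Longrightarrow>
        slope_vector z (laurent_eval (zero_part T) z) (laurent_eval (infinity_part T) z) r s"
    unfolding rational_tangle_def by blast
  have "loop_value * zero_part T + infinity_part T = Poly_Mapping.single 2 (-1) * zero_part T +
      Poly_Mapping.single (-2) (-1) * zero_part T + infinity_part T"
    by (simp add: loop_value_def single_uminus ring_distribs)
  moreover have "keys_mod_4 (c + 2) \<dots>"
    by (intro keys_mod_4_add keys_mod_4_single_mult[OF c(1)] c(2)) simp_all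
  ultimately show "\<exists>c. keys_mod_4 c (kauffman_bracket (numerator_closure T))"
    unfolding bracket_numerator_closure[OF pl] by metis
  assume z: "z ^ 8 - z ^ 4 + 1 = 0"
  have "laurent_eval loop_value z = - (z ^ 2) - 1 / z ^ 2"
    by (simp add: loop_value_def power_int_minus divide_inverse)
  then show "cmod (laurent_eval (kauffman_bracket (numerator_closure T)) z) =
      (if 3 dvd r then sqrt 3 else 1)"
    using slope_vector_closure[OF z v[OF z]] primitive_24th_root[OF z]
    unfolding bracket_numerator_closure[OF pl] by simp
qed

text \<open>The hypothesis makes \<open>t\<close> a primitive 12th root of unity and
  \<open>z\<close>, an inverse square root of it, a primitive 24th one; the writhe factor has
  modulus 1.\<close>

lemma jones_polynomial_norm:
  assumes "rational_tangle T r s" "is_orientation (numerator_closure T) os" "t ^ 4 - t ^ 2 + 1 = 0"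
  shows "cmod (laurent_eval (jones_polynomial (numerator_closure T) os) t) =
    (if 3 dvd r then sqrt 3 else 1)"
proof -
  define z where "z = inverse (csqrt t)"
  have t0: "t \<noteq> 0"
    using assms(3) by auto
  then have z0: "z \<noteq> 0" and z2: "z ^ 2 = inverse t"
    by (simp_all add: z_def power_inverse)
  have "z ^ 8 - z ^ 4 + 1 = (z ^ 2) ^ 4 - (z ^ 2) ^ 2 + 1"
    by (simp flip: power_mult)
  also have "\<dots> = (t ^ 4 - t ^ 2 + 1) / t ^ 4"
    unfolding z2 using t0 by (simp add: field_simps eval_nat_numeral)
  finally have z: "z ^ 8 - z ^ 4 + 1 = 0"
    using assms(3) by simp
  have "laurent_eval (jones_polynomial (numerator_closure T) os) t =
      laurent_eval (writhe_normalized_bracket (numerator_closure T) os) z"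
    by (rule laurent_eval_jones_polynomial[OF assms(2) z0]) (simp add: z2)
  then show ?thesis
    using rational_tangle_bracket(2)[OF assms(1) z] primitive_24th_root[OF z]
    by (simp add: writhe_normalized_bracket_def norm_mult norm_power_int)
qed

theorem theorem8p1:
  fixes r s :: int and os :: "(bool \<times> bool) list"
  assumes "coprime r s" and "s > 0" and "rat_of_int r / rat_of_int s > 1"
    and "is_orientation (rational_link (rat_of_int r / rat_of_int s)) os"
  shows "(\<not> 3 dvd r \<longrightarrow>
            jones_J (rat_of_int r / rat_of_int s) os omega
              \<in> {1, -1, omega, - omega, omega ^ 2, - (omega ^ 2)}) \<and>
         (3 dvd r \<longrightarrow>
            jones_J (rat_of_int r / rat_of_int s) os omega
              \<in> {1 - omega, - (1 - omega), omega * (1 - omega), - (omega * (1 - omega)),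
                 omega ^ 2 * (1 - omega), - (omega ^ 2 * (1 - omega))}) \<and>
         (\<forall>t_half :: complex. t_half ^ 2 = - omega \<longrightarrow>
            cmod (laurent_eval (jones_V (rat_of_int r / rat_of_int s) os) t_half)
              = cmod (jones_J (rat_of_int r / rat_of_int s) os omega)) \<and>
         cmod (jones_J (rat_of_int r / rat_of_int s) os omega) = (if 3 dvd r then sqrt 3 else 1)"
proof -
  let ?\<alpha> = "rat_of_int r / rat_of_int s"
  define T where "T = cf_tangle (cfrac (nat r) (nat s))"
  define V where "V = jones_V ?\<alpha> os"
  define t where "t = csqrt (- inverse omega)"
  define m where "m = Max (Poly_Mapping.keys V)"
  define J where "J = jones_J ?\<alpha> os omega"
  have r: "r > 0"
    using assms(2,3) by (simp add: less_divide_eq)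
  have "quotient_of ?\<alpha> = (r, s)"
    using assms(1,2) by (metis Fract_of_int_quotient normalize_stable quotient_of_Fract)
  then have link: "rational_link ?\<alpha> = numerator_closure T"
    by (simp add: rational_link_def T_def)
  have "coprime (nat r) (nat s)"
    using assms(1,2) r by (metis coprime_int_iff int_nat_eq less_imp_le)
  from rational_tangle_cfrac[OF this] have T: "rational_tangle T r s"
    using r assms(2) by (simp add: T_def)
  have V: "V = jones_polynomial (numerator_closure T) os"
    and os: "is_orientation (numerator_closure T) os"
    using assms(4) by (simp_all add: V_def jones_V_def link)
  have norm_V: "cmod (laurent_eval V x) = (if 3 dvd r then sqrt 3 else 1)"
    if "x ^ 4 - x ^ 2 + 1 = 0" for x
    unfolding V using T os that by (rule jones_polynomial_norm)
  have t2: "t ^ 2 = - inverse omega"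
    by (simp add: t_def)
  have "t ^ 4 = (t ^ 2) ^ 2"
    by (simp flip: power_mult)
  then have "t ^ 4 - t ^ 2 + 1 = 0"
    by (simp add: t2 inverse_omega power2_sum power2_diff omega_square)
  note norm_V_t = norm_V[OF this]
  \<comment> \<open>Its value at \<open>t\<close> is nonzero. Hence \<open>m\<close> is a true
    exponent and the sign in the normalization is 1 or -1, never 0.\<close>
  have V0: "V \<noteq> 0"
    using norm_V_t by (auto split: if_splits)
  then have "m \<in> Poly_Mapping.keys V"
    unfolding m_def by (intro Max_in) simp_all
  then have sgn: "sgn (Poly_Mapping.lookup V m) \<in> {1, -1}"
    by (simp add: in_keys_iff sgn_if)
  have J: "J = of_int (sgn (Poly_Mapping.lookup V m)) * (t powi (- m) * laurent_eval V t)"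
    by (simp add: J_def jones_J_def normalize_jones_def Let_def V_def m_def t_def mult.assoc)
  obtain m0 where "\<forall>k\<in>Poly_Mapping.keys V. even (k - m0)"
    using jones_polynomial_keys[OF os] rational_tangle_bracket(1)[OF T] unfolding V by blast
  \<comment> \<open>All exponents share the parity of \<open>m0\<close>, and \<open>m\<close> is one
    of them.\<close>
  then have "even (k - m)" if "k \<in> Poly_Mapping.keys V" for k
    using that \<open>m \<in> _\<close> by fastforce
  then have "J \<in> eisenstein"
    unfolding J by (intro eisenstein_mult eisenstein_of_int laurent_eval_eisenstein t2)
  have "cmod omega = 1"
    by (simp add: omega_Complex cmod_def power2_eq_square)
  then have "cmod t ^ 2 = 1"
    by (metis norm_inverse norm_minus_cancel norm_power t2 inverse_1)
  then have "cmod t = 1"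
    by (metis norm_ge_zero real_sqrt_one real_sqrt_unique)
  then have norm_J: "cmod J = (if 3 dvd r then sqrt 3 else 1)"
    unfolding J using norm_V_t sgn by (auto simp: norm_mult norm_power_int)
  \<comment> \<open>The normalization evaluates the Jones polynomial at - 1/omega, but the claim
    concerns - omega. These are the two primitive sixth roots of unity, and \<open>norm_V\<close>
    covers the square roots of both.\<close>
  have "cmod (laurent_eval V x) = cmod J" if x: "x ^ 2 = - omega" for x
  proof -
    have "x ^ 4 = (x ^ 2) ^ 2"
      by (simp flip: power_mult)
    then show ?thesis
      unfolding norm_J by (intro norm_V) (simp add: x omega_square)
  qed
  moreover have "\<not> 3 dvd r \<Longrightarrow> J \<in> {1, -1, omega, - omega, omega ^ 2, - (omega ^ 2)}"
    using \<open>J \<in> eisenstein\<close> norm_J by (intro eisenstein_norm_1) simp_all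
  moreover have "3 dvd r \<Longrightarrow> J \<in> {1 - omega, - (1 - omega), omega * (1 - omega),
      - (omega * (1 - omega)), omega ^ 2 * (1 - omega), - (omega ^ 2 * (1 - omega))}"
    using \<open>J \<in> eisenstein\<close> norm_J by (intro eisenstein_norm_3) simp_all
  ultimately show ?thesis
    using norm_J unfolding J_def V_def by blast
qed

end
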